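(* Let $\mathbb{F}$ be a field of characteristic zero, $\Gamma$ an additive subgroup of $\mathbb{F}$, and $\mathcal{L}$ the generalized Ramond $N=2$ superconformal algebra associated with $\Gamma$. Then $Der\,\mathcal{L}$ is spanned by $ad\,\mathcal{L}$ and $\mathrm{Hom}_{\mathbb{Z}}(\Gamma,\mathbb{F})$ (each additive homomorphism $\varphi:\Gamma\to\mathbb{F}$ being regarded as the derivation $x_\alpha\mapsto\varphi(\alpha)x_\alpha$ for $x_\alpha\in\mathcal{L}_\alpha$, $\alpha\in\Gamma$). In detail, $$Der\,\mathcal{L}=\bigoplus_{\alpha\in\Gamma}(Der\,\mathcal{L})_\alpha=(Der\,\mathcal{L})_{\overline{0}}\oplus(Der\,\mathcal{L})_{\overline{1}},$$ where $$(Der\,\mathcal{L})_{\overline{1}}=ad\,\mathcal{L}_{\overline{1}},$$ $$(Der\,\mathcal{L})_{\overline{0}}\cap(Der\,\mathcal{L})_\alpha=ad(\mathcal{L}_{\overline{0}}\cap\mathcal{L}_\alpha)\quad\text{for all }\alpha\in\Gamma,\ \alpha\neq 0,$$ $$(Der\,\mathcal{L})_{\overline{0}}\cap(Der\,\mathcal{L})_0=ad\,\mathcal{L}'_0+\mathrm{Hom}_{\mathbb{Z}}(\Gamma,\mathbb{F}),\qquad \mathcal{L}'_0=\mathrm{span}_{\mathbb{F}}\{L_0,H_0\},$$ and $(Der\,\mathcal{L})_{\overline{0}}\cap ad\,\mathcal{L}_0=\{ad(kL_0+lH_0)\mid k,l\in\mathbb{F}\}$, where $\mathcal{L}_0$ is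 the degree-$0$ component of $\mathcal{L}$.
   Context: The generalized Ramond $N=2$ superconformal algebra. Let $\mathbb{F}$ be a field of characteristic zero and $\Gamma$ an additive subgroup of $\mathbb{F}$. $\mathcal{L}=\mathcal{L}_{\overline{0}}\oplus\mathcal{L}_{\overline{1}}$ is the Lie superalgebra over $\mathbb{F}$ whose even part $\mathcal{L}_{\overline 0}$ has basis $\{L_\alpha,H_\beta,c\mid\alpha,\beta\in\Gamma\}$ and whose odd part $\mathcal{L}_{\overline 1}$ has basis $\{G^-_\alpha,G^+_\beta\mid\alpha,\beta\in\Gamma\}$, with brackets, for $\alpha,\beta\in\Gamma$, $$[L_\alpha,L_\beta]=(\alpha-\beta)L_{\alpha+\beta}+\tfrac{c}{12}(\alpha^3-\alpha)\delta_{\alpha+\beta,0},\quad [H_\alpha,H_\beta]=\tfrac{\alpha}{3}c\,\delta_{\alpha+\beta,0},\quad [L_\alpha,H_\beta]=-\beta H_{\alpha+\beta},$$ $$[L_\alpha,G^\pm_\beta]=(\tfrac{\alpha}{2}-\beta)G^\pm_{\alpha+\beta},\quad [H_\alpha,G^\pm_\beta]=\pm G^\pm_{\alpha+\beta},$$ $$[G^-_\alpha,G^+_\beta]=2L_{\alpha+\beta}-(\alpha-\beta)H_{\alpha+\beta}+\tfrac{c}{3}(\alpha^2-\tfrac14)\delta_{\alpha+\beta,0},$$ with $c$ central and $[G^+_\alpha,G^+_\beta]=[G^-_\alpha,G^-_\beta]=0$; $\delta_{m,n}$ is the Kronecker delta. $\mathcal{L}$ is $\Gamma$-graded: $\mathcal{L}=\bigoplus_{\alpha\in\Gamma}\mathcal{L}_\alpha$,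 $\mathcal{L}_\alpha=\{x\in\mathcal{L}\mid[L_0,x]=-\alpha x\}=\mathrm{span}_{\mathbb{F}}\{L_\alpha,H_\alpha,G^\pm_\alpha,\delta_{\alpha,0}c\}$. Derivations. $(Der\,\mathcal{L})_{\overline{j}}$ is the space of (super)derivations $D$ of $\mathcal{L}$ of parity $\overline j\in\mathbb{Z}_2$: linear maps with $D(\mathcal{L}_{\overline i})\subseteq\mathcal{L}_{\overline{i+j}}$ and $D[x,y]=[Dx,y]+(-1)^{j|x|}[x,Dy]$ for homogeneous $x$; $Der\,\mathcal{L}=(Der\,\mathcal{L})_{\overline0}\oplus(Der\,\mathcal{L})_{\overline1}$. For $\gamma\in\Gamma$, $(Der\,\mathcal{L})_\gamma=\{D\in Der\,\mathcal{L}\mid D(\mathcal{L}_\beta)\subseteq\mathcal{L}_{\beta+\gamma}\ \forall\beta\in\Gamma\}$. For a subset $S\subseteq\mathcal{L}$, $ad\,S=\{ad\,x\mid x\in S\}$ with $ad\,x(y)=[x,y]$; $ad\,\mathcal{L}$ is the set of inner derivations. $\mathrm{Hom}_{\mathbb{Z}}(\Gamma,\mathbb{F})$ is the set of additive group homomorphisms $\Gamma\to\mathbb{F}$.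
   Formalization: The subgroup Γ is assumed nonzero: for Γ = {0} the claim fails, since the linear map sending H_0 to c and the other basis elements to 0 is an even degree-0 derivation that is neither inner nor in Hom(Γ,F) = 0. *)

theory Defs
  imports Complex_Main "HOL-Library.Poly_Mapping" "HOL-Library.Function_Algebras" "HOL-Library.Z2"
begin

(* Basis symbols.  Indices range over the whole field here; the algebra attached to a subgroup
   \<Gamma> of the field is the span of the symbols with index in \<Gamma> (and of the central symbol). *)

datatype 'f gen = L 'f | H 'f | C | Gm 'f | Gp 'f

type_synonym 'f vec = "'f gen \<Rightarrow>\<^sub>0 'f"

definition scl :: "'f::field \<Rightarrow> 'f vec \<Rightarrow> 'f vec" where
  "scl k x = Poly_Mapping.map ((*) k) x"

definition bas :: "'f::field gen \<Rightarrow> 'f vec" where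
  "bas g = Poly_Mapping.single g 1"

lemma lookup_scl [simp]: "Poly_Mapping.lookup (scl k x) g = k * Poly_Mapping.lookup x g"
  by (simp add: scl_def Poly_Mapping.map.rep_eq when_def)

global_interpretation vec: vector_space "scl :: 'f::field \<Rightarrow> 'f vec \<Rightarrow> 'f vec"
  by standard (auto intro!: poly_mapping_eqI simp: lookup_add algebra_simps)

definition mscl :: "'f::field \<Rightarrow> ('f vec \<Rightarrow> 'f vec) \<Rightarrow> ('f vec \<Rightarrow> 'f vec)" where
  "mscl k D = (\<lambda>x. scl k (D x))"

global_interpretation maps: vector_space "mscl :: 'f::field \<Rightarrow> ('f vec \<Rightarrow> 'f vec) \<Rightarrow> ('f vec \<Rightarrow> 'f vec)"
  by standard (auto simp: fun_eq_iff mscl_def vec.scale_right_distrib vec.scale_left_distrib)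

(* Brackets of basis symbols; the orders not listed in the defining relations are obtained by
   super skew-symmetry (symmetric on two odd symbols, skew-symmetric otherwise). *)

fun brk :: "'f::field_char_0 gen \<Rightarrow> 'f gen \<Rightarrow> 'f vec" where
  "brk (L a) (L b) = scl (a - b) (bas (L (a + b)))
     + (if a + b = 0 then scl ((a^3 - a) / 12) (bas C) else 0)"
| "brk (H a) (H b) = (if a + b = 0 then scl (a / 3) (bas C) else 0)"
| "brk (L a) (H b) = scl (- b) (bas (H (a + b)))"
| "brk (L a) (Gp b) = scl (a / 2 - b) (bas (Gp (a + b)))"
| "brk (L a) (Gm b) = scl (a / 2 - b) (bas (Gm (a + b)))"
| "brk (H a) (Gp b) = bas (Gp (a + b))"
| "brk (H a) (Gm b) = - bas (Gm (a + b))"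
| "brk (Gm a) (Gp b) = scl 2 (bas (L (a + b))) - scl (a - b) (bas (H (a + b)))
     + (if a + b = 0 then scl ((a^2 - 1/4) / 3) (bas C) else 0)"
| "brk (H b) (L a) = scl b (bas (H (a + b)))"
| "brk (Gp b) (L a) = - scl (a / 2 - b) (bas (Gp (a + b)))"
| "brk (Gm b) (L a) = - scl (a / 2 - b) (bas (Gm (a + b)))"
| "brk (Gp b) (H a) = - bas (Gp (a + b))"
| "brk (Gm b) (H a) = bas (Gm (a + b))"
| "brk (Gp b) (Gm a) = scl 2 (bas (L (a + b))) - scl (a - b) (bas (H (a + b)))
     + (if a + b = 0 then scl ((a^2 - 1/4) / 3) (bas C) else 0)"
| "brk (Gp a) (Gp b) = 0"
| "brk (Gm a) (Gm b) = 0"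
| "brk C g = 0"
| "brk g C = 0"

definition lie :: "'f::field_char_0 vec \<Rightarrow> 'f vec \<Rightarrow> 'f vec" where
  "lie x y = (\<Sum>g\<in>Poly_Mapping.keys x. \<Sum>h\<in>Poly_Mapping.keys y.
     scl (Poly_Mapping.lookup x g * Poly_Mapping.lookup y h) (brk g h))"

definition additive_subgroup :: "'f::field_char_0 set \<Rightarrow> bool" where
  "additive_subgroup \<Gamma> \<longleftrightarrow> 0 \<in> \<Gamma> \<and> (\<forall>a\<in>\<Gamma>. \<forall>b\<in>\<Gamma>. a + b \<in> \<Gamma>) \<and> (\<forall>a\<in>\<Gamma>. - a \<in> \<Gamma>)"

fun gens :: "'f::field_char_0 set \<Rightarrow> bit \<Rightarrow> 'f gen set" where
  "gens \<Gamma> 0 = L ` \<Gamma> \<union> H ` \<Gamma> \<union> {C}"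
| "gens \<Gamma> 1 = Gm ` \<Gamma> \<union> Gp ` \<Gamma>"

definition alg :: "'f::field_char_0 set \<Rightarrow> 'f vec set" where
  "alg \<Gamma> = vec.span (bas ` (gens \<Gamma> 0 \<union> gens \<Gamma> 1))"

definition alg_par :: "'f::field_char_0 set \<Rightarrow> bit \<Rightarrow> 'f vec set" where
  "alg_par \<Gamma> i = vec.span (bas ` gens \<Gamma> i)"

definition alg_deg :: "'f::field_char_0 set \<Rightarrow> 'f \<Rightarrow> 'f vec set" where
  "alg_deg \<Gamma> \<alpha> = {x \<in> alg \<Gamma>. lie (bas (L 0)) x = scl (- \<alpha>) x}"

(* Linear endomorphisms of alg \<Gamma>.  They are represented by functions on the ambient space that
   vanish outside alg \<Gamma>, so that equality of functions is equality of endomorphisms and the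
   vector space operations are the pointwise ones. *)

definition lin_end :: "'f::field_char_0 set \<Rightarrow> ('f vec \<Rightarrow> 'f vec) set" where
  "lin_end \<Gamma> = {D. (\<forall>x\<in>alg \<Gamma>. D x \<in> alg \<Gamma>) \<and>
     (\<forall>x\<in>alg \<Gamma>. \<forall>y\<in>alg \<Gamma>. D (x + y) = D x + D y) \<and>
     (\<forall>k. \<forall>x\<in>alg \<Gamma>. D (scl k x) = scl k (D x)) \<and>
     (\<forall>x. x \<notin> alg \<Gamma> \<longrightarrow> D x = 0)}"

(* The Koszul sign (-1)^(i j) for i, j in Z/2. *)
definition ksign :: "bit \<Rightarrow> bit \<Rightarrow> 'f::field" where
  "ksign i j = (if i = 1 \<and> j = 1 then - 1 else 1)"

definition Der_par :: "'f::field_char_0 set \<Rightarrow> bit \<Rightarrow> ('f vec \<Rightarrow> 'f vec) set" where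
  "Der_par \<Gamma> j = {D \<in> lin_end \<Gamma>.
     (\<forall>i. \<forall>x\<in>alg_par \<Gamma> i. D x \<in> alg_par \<Gamma> (i + j)) \<and>
     (\<forall>i. \<forall>x\<in>alg_par \<Gamma> i. \<forall>y\<in>alg \<Gamma>. D (lie x y) = lie (D x) y + scl (ksign j i) (lie x (D y)))}"

definition Der :: "'f::field_char_0 set \<Rightarrow> ('f vec \<Rightarrow> 'f vec) set" where
  "Der \<Gamma> = {D + E | D E. D \<in> Der_par \<Gamma> 0 \<and> E \<in> Der_par \<Gamma> 1}"

definition Der_deg :: "'f::field_char_0 set \<Rightarrow> 'f \<Rightarrow> ('f vec \<Rightarrow> 'f vec) set" where
  "Der_deg \<Gamma> \<gamma> = {D \<in> Der \<Gamma>. \<forall>\<beta>\<in>\<Gamma>. \<forall>x\<in>alg_deg \<Gamma> \<beta>. D x \<in> alg_deg \<Gamma> (\<beta> + \<gamma>)}"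

definition ad :: "'f::field_char_0 set \<Rightarrow> 'f vec \<Rightarrow> 'f vec \<Rightarrow> 'f vec" where
  "ad \<Gamma> x = (\<lambda>y. if y \<in> alg \<Gamma> then lie x y else 0)"

(* Additive maps from \<Gamma> to the field; values outside \<Gamma> are irrelevant. *)
definition add_homs :: "'f::field_char_0 set \<Rightarrow> ('f \<Rightarrow> 'f) set" where
  "add_homs \<Gamma> = {\<phi>. \<forall>a\<in>\<Gamma>. \<forall>b\<in>\<Gamma>. \<phi> (a + b) = \<phi> a + \<phi> b}"

(* The additive maps regarded as endomorphisms of alg \<Gamma>. *)
definition hom_ders :: "'f::field_char_0 set \<Rightarrow> ('f vec \<Rightarrow> 'f vec) set" where
  "hom_ders \<Gamma> = {D \<in> lin_end \<Gamma>. \<exists>\<phi>\<in>add_homs \<Gamma>. \<forall>\<alpha>\<in>\<Gamma>. \<forall>x\<in>alg_deg \<Gamma> \<alpha>. D x = scl (\<phi> \<alpha>) x}"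

(* V is the internal direct sum of the subspaces W i, i in I. *)
definition internal_direct_sum ::
    "('f::field vec \<Rightarrow> 'f vec) set \<Rightarrow> 'i set \<Rightarrow> ('i \<Rightarrow> ('f vec \<Rightarrow> 'f vec) set) \<Rightarrow> bool" where
  "internal_direct_sum V I W \<longleftrightarrow>
     (\<forall>i\<in>I. maps.subspace (W i)) \<and> V = maps.span (\<Union>i\<in>I. W i) \<and>
     (\<forall>J f. finite J \<and> J \<subseteq> I \<and> (\<forall>i\<in>J. f i \<in> W i) \<and> (\<Sum>i\<in>J. f i) = 0 \<longrightarrow> (\<forall>i\<in>J. f i = 0))"

end

(*
  Bracketing with H_0 measures the charge (1 on G^+, -1 on G^-, 0 on the even part), and bracketing
  with L_0 measures minus the degree.

  An odd derivation D sends H_0 to a combination of G^+'s and G^-'s, on which ad H_0 is invertible,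
  so an inner derivation can be subtracted to get D(H_0) = 0.  Then D commutes with ad H_0 and
  preserves the charge; being odd, it vanishes.

  For an even derivation D, dividing the components of D(L_0) of nonzero degree by their degree gives
  an inner derivation whose subtraction leaves D(L_0) in degree 0.  Comparing components in
  D[L_0, x] then shows that D preserves the degree.  So \<Gamma> need not be finitely generated.

  An even derivation of degree 0 is given by finitely many scalar functions on \<Gamma>.  The brackets of
  H_\<alpha> and L_\<alpha> with G^+_\<beta> yield a quadratic polynomial in \<alpha>/2 - \<beta> with three distinct roots (for
  \<beta> = 0, \<alpha>, -\<alpha>), which leaves one additive function and one scalar, the multiple of ad H_0; the
  central terms of [G^-, G^+] remove all components along C.
*)
theory Submission
  imports Defs
begin

section \<open>Bilinearity of the bracket\<close>

abbreviation "lookup \<equiv> Poly_Mapping.lookup"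
abbreviation "keys \<equiv> Poly_Mapping.keys"

lemma lookup_bas: "lookup (bas g) h = (if g = h then 1 else 0)"
  by (simp add: bas_def lookup_single when_def)

lemma keys_bas [simp]: "keys (bas g :: 'f::field vec) = {g}"
  by (simp add: bas_def)

lemma keys_scl: "keys (scl k x) \<subseteq> keys x"
  by (auto simp: in_keys_iff)

text \<open>\<open>lie\<close> sums over the exact supports, which change under addition and under
  scaling by 0. Summing over fixed larger sets makes bilinearity a termwise fact.\<close>

lemma lie_superset:
  assumes "finite A" "finite B" "keys x \<subseteq> A" "keys y \<subseteq> B"
  shows "lie x y = (\<Sum>g\<in>A. \<Sum>h\<in>B. scl (lookup x g * lookup y h) (brk g h))"
proof -
  have "lie x y = (\<Sum>g\<in>keys x. \<Sum>h\<in>B. scl (lookup x g * lookup y h) (brk g h))"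
    unfolding lie_def using assms by (intro sum.cong sum.mono_neutral_left) (auto simp: in_keys_iff)
  also have "\<dots> = (\<Sum>g\<in>A. \<Sum>h\<in>B. scl (lookup x g * lookup y h) (brk g h))"
    using assms by (intro sum.mono_neutral_left) (auto simp: in_keys_iff)
  finally show ?thesis .
qed

lemma lie_bas: "lie (bas g) (bas h) = brk g h"
  by (simp add: lie_def lookup_bas)

lemma lie_add_left: "lie (x + y) z = lie x z + lie y z"
proof -
  let ?A = "keys x \<union> keys y" and ?B = "keys z"
  have A: "finite ?A" "finite ?B" "keys (x + y) \<subseteq> ?A"
    using keys_add[of x y] by auto
  show ?thesis
    using A by (simp add: lie_superset[of ?A ?B] lookup_add distrib_right vec.scale_left_distrib sum.distrib)
qed

lemma lie_add_right: "lie z (x + y) = lie z x + lie z y"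
proof -
  let ?A = "keys x \<union> keys y" and ?B = "keys z"
  have A: "finite ?A" "finite ?B" "keys (x + y) \<subseteq> ?A"
    using keys_add[of x y] by auto
  show ?thesis
    using A by (simp add: lie_superset[of ?B ?A] lookup_add distrib_left vec.scale_left_distrib sum.distrib)
qed

lemma lie_scl_left: "lie (scl k x) y = scl k (lie x y)"
proof -
  have "lie (scl k x) y = (\<Sum>g\<in>keys x. \<Sum>h\<in>keys y.
      scl (lookup (scl k x) g * lookup y h) (brk g h))"
    by (rule lie_superset) (auto simp: keys_scl[THEN subsetD])
  then show ?thesis by (simp add: lie_def vec.scale_sum_right mult.assoc)
qed

lemma lie_scl_right: "lie x (scl k y) = scl k (lie x y)"
proof -
  have "lie x (scl k y) = (\<Sum>g\<in>keys x. \<Sum>h\<in>keys y.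
      scl (lookup x g * lookup (scl k y) h) (brk g h))"
    by (rule lie_superset) (auto simp: keys_scl[THEN subsetD])
  then show ?thesis by (simp add: lie_def vec.scale_sum_right mult.assoc mult.left_commute)
qed

lemma lie_zero [simp]: "lie 0 x = 0" "lie x 0 = 0"
  by (simp_all add: lie_def)

lemma lie_minus_left: "lie (- x) y = - lie x y"
  using lie_scl_left[of "-1" x y] by simp

lemma lie_minus_right: "lie x (- y) = - lie x y"
  using lie_scl_right[of x "-1" y] by simp

lemma lie_diff_left: "lie (x - y) z = lie x z - lie y z"
  using lie_add_left[of x "- y" z] by (simp add: lie_minus_left)

lemma lie_diff_right: "lie z (x - y) = lie z x - lie z y"
  using lie_add_right[of z x "- y"] by (simp add: lie_minus_right)

lemmas lie_linear = lie_add_left lie_add_right lie_scl_left lie_scl_right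
  lie_minus_left lie_minus_right lie_diff_left lie_diff_right

section \<open>The super Jacobi identity on basis symbols\<close>

fun deg :: "'f::zero gen \<Rightarrow> 'f" where
  "deg (L a) = a" | "deg (H a) = a" | "deg C = 0" | "deg (Gm a) = a" | "deg (Gp a) = a"

fun par :: "'f gen \<Rightarrow> bit" where
  "par (L a) = 0" | "par (H a) = 0" | "par C = 0" | "par (Gm a) = 1" | "par (Gp a) = 1"

definition delta :: "'f::field \<Rightarrow> 'f \<Rightarrow> 'f" where
  "delta s k = (if s = 0 then k else 0)"

text \<open>With the central terms written as multiples of \<open>C\<close>, inner brackets lose them without a case
  split on their Kronecker deltas.\<close>
lemma brk_central:
  "brk (L a) (L b) = scl (a - b) (bas (L (a + b))) + scl (delta (a + b) ((a^3 - a) / 12)) (bas C)"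
  "brk (H a) (H b) = scl (delta (a + b) (a / 3)) (bas C)"
  "brk (Gm a) (Gp b) = scl 2 (bas (L (a + b))) - scl (a - b) (bas (H (a + b)))
     + scl (delta (a + b) ((a^2 - 1/4) / 3)) (bas C)"
  "brk (Gp b) (Gm a) = scl 2 (bas (L (a + b))) - scl (a - b) (bas (H (a + b)))
     + scl (delta (a + b) ((a^2 - 1/4) / 3)) (bas C)"
  by (simp_all add: delta_def)

declare brk.simps(1,2,8,14) [simp del]

lemma delta_zero [simp]: "delta 0 k = k"
  by (simp add: delta_def)

lemma delta_nonzero: "s \<noteq> 0 \<Longrightarrow> delta s k = 0"
  by (simp add: delta_def)

lemma brk_C [simp]: "brk g C = 0"
  by (cases g) auto

lemma lie_bas_C: "lie (bas C) x = 0" "lie x (bas C) = 0"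
  by (simp_all add: lie_def lookup_bas)

text \<open>As \<open>C\<close> is central, inner central terms disappear under a further bracket,
  and outer ones carry a delta in the total degree. If that degree is 0, eliminating
  \<open>deg k\<close> leaves polynomial identities in two indices; otherwise every remaining delta
  is zero.\<close>

lemma jacobi_bas:
  "lie (bas g) (brk h k) = lie (brk g h) (bas k) + scl (ksign (par g) (par h)) (lie (bas h) (brk g k))"
proof (cases "g = C \<or> h = C \<or> k = C")
  case True
  then show ?thesis by (auto simp: lie_bas_C)
next
  case nC: False
  show ?thesis
  proof (cases "deg g + deg h + deg k = 0")
    case True
    then have k: "deg k = - deg g - deg h" by (simp add: algebra_simps eq_neg_iff_add_eq_0)
    show ?thesis
      by (insert nC k, cases g; cases h; cases k;
          simp add: lie_linear lie_bas brk_central ksign_def;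
          (rule poly_mapping_eqI)?;
          (simp add: lookup_add lookup_minus power2_eq_square power3_eq_cube field_simps)?)
  next
    case False
    show ?thesis
      by (insert nC False, cases g; cases h; cases k;
          simp add: lie_linear lie_bas brk_central ksign_def add_ac delta_nonzero;
          (rule poly_mapping_eqI)?;
          (simp add: lookup_add lookup_minus algebra_simps add_divide_distrib diff_divide_distrib)?)
  qed
qed

section \<open>Supports of brackets, and extension from symbols to vectors\<close>

lemma sum_fun_apply: "(\<Sum>i\<in>J. f i) x = (\<Sum>i\<in>J. f i x)"
  by (induction J rule: infinite_finite_induct) auto

lemma lookup_scl_bas: "lookup (scl c (bas g)) h = (if g = h then c else 0)"
  by (simp add: lookup_bas)

lemma keys_brk:
  assumes "k \<in> keys (brk g h)"
  shows "deg k = deg g + deg h" "par k = par g + par h"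
proof -
  have "lookup (brk g h) k \<noteq> 0" using assms by (simp add: in_keys_iff)
  then have "deg k = deg g + deg h \<and> par k = par g + par h"
    by (cases g; cases h)
       (auto simp: brk_central lookup_add lookup_minus lookup_bas delta_def add.commute split: if_splits)
  then show "deg k = deg g + deg h" "par k = par g + par h" by auto
qed

text \<open>Common source of \<open>lie_alg\<close>, \<open>lie_alg_par\<close> and
  \<open>lie_alg_deg\<close>: a symbol occurring in a bracket must occur in some
  \<open>brk g h\<close>, where degrees and parities add.\<close>

lemma keys_lie:
  assumes "k \<in> keys (lie x y)"
  obtains g h where "g \<in> keys x" "h \<in> keys y" "deg k = deg g + deg h" "par k = par g + par h"
proof -
  have "\<exists>g\<in>keys x. \<exists>h\<in>keys y. lookup (brk g h) k \<noteq> 0"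
  proof (rule ccontr)
    assume "\<not> ?thesis"
    then have "lookup (lie x y) k = 0"
      by (simp add: lie_def lookup_sum)
    with assms show False by (simp add: in_keys_iff)
  qed
  then obtain g h where gh: "g \<in> keys x" "h \<in> keys y" "k \<in> keys (brk g h)"
    by (auto simp: in_keys_iff)
  show ?thesis by (rule that[OF gh(1,2) keys_brk[OF gh(3)]])
qed

text \<open>Linear extension from symbols. The step provides \<open>keys y \<subseteq> S\<close>
  because maps in \<open>lin_end\<close> are additive only on the algebra, so membership of
  \<open>y\<close> must be at hand.\<close>

lemma supported_induct [consumes 1, case_names zero step]:
  fixes x :: "'f::field vec"
  assumes "keys x \<subseteq> S" "P 0"
    and step: "\<And>c g y. g \<in> S \<Longrightarrow> keys y \<subseteq> S \<Longrightarrow> P y \<Longrightarrow> P (scl c (bas g) + y)"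
  shows "P x"
proof -
  have "P (\<Sum>g\<in>A. scl (lookup x g) (bas g)) \<and> keys (\<Sum>g\<in>A. scl (lookup x g) (bas g)) \<subseteq> S"
    if "finite A" "A \<subseteq> S" for A
    using that
  proof (induction A rule: finite_induct)
    case empty
    then show ?case using assms by simp
  next
    case (insert a A)
    let ?y = "\<Sum>g\<in>A. scl (lookup x g) (bas g)"
    have "keys (scl (lookup x a) (bas a) + ?y) \<subseteq> S"
      using insert keys_add[of "scl (lookup x a) (bas a)" ?y] keys_scl[of "lookup x a" "bas a"] by auto
    then show ?case using insert step by simp
  qed
  from this[of "keys x"] have "P (\<Sum>g\<in>keys x. scl (lookup x g) (bas g))"
    using assms by simp
  also have "(\<Sum>g\<in>keys x. scl (lookup x g) (bas g)) = x"
    by (rule poly_mapping_eqI) (simp add: lookup_sum lookup_scl_bas in_keys_iff del: lookup_scl)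
  finally show ?thesis .
qed

text \<open>Replaces the spans in the definitions by conditions on \<open>keys\<close>, which can be
  checked one coordinate at a time.\<close>

lemma span_bas: "vec.span (bas ` S) = {x. keys x \<subseteq> S}"
proof (intro set_eqI iffI)
  fix x :: "'a vec"
  assume "x \<in> vec.span (bas ` S)"
  then have "keys x \<subseteq> S"
  proof (induction rule: vec.span_induct_alt)
    case base
    then show ?case by simp
  next
    case (step c x y)
    then obtain g where "x = bas g" "g \<in> S" by blast
    then have "keys (scl c x) \<subseteq> S" using keys_scl[of c x] by auto
    then show ?case using keys_add[of "scl c x" y] step by (meson Un_least order_trans)
  qed
  then show "x \<in> {x. keys x \<subseteq> S}" by simp
next
  fix x :: "'a vec"
  assume "x \<in> {x. keys x \<subseteq> S}"
  then have "keys x \<subseteq> S" by simp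
  then show "x \<in> vec.span (bas ` S)"
    by (induction rule: supported_induct)
       (auto intro: vec.span_zero vec.span_add vec.span_scale vec.span_base)
qed

text \<open>Rescaling coordinates cannot enlarge the support. This supplies the elements whose inner
  derivations are subtracted later: bracketing with \<open>bas (H 0)\<close> or
  \<open>bas (L 0)\<close> is diagonal and gets inverted coordinatewise.\<close>

lemma ex_rescaled:
  fixes x :: "'f::field vec"
  obtains y where "\<And>g. lookup y g = c g * lookup x g"
proof -
  have "lookup (\<Sum>g\<in>keys x. scl (c g * lookup x g) (bas g)) h = c h * lookup x h" for h
    by (simp add: lookup_sum lookup_scl_bas in_keys_iff del: lookup_scl)
  then show ?thesis using that by blast
qed

text \<open>Trilinear extension of \<open>jacobi_bas\<close>, one argument at a time from right to
  left. The sign involves only the first two parities, so \<open>z\<close> may mix parities.\<close>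

lemma jacobi:
  assumes "keys x \<subseteq> {g. par g = i}" "keys y \<subseteq> {g. par g = j}"
  shows "lie x (lie y z) = lie (lie x y) z + scl (ksign i j) (lie y (lie x z))"
proof -
  have 1: "lie (bas g) (lie (bas h) z) = lie (lie (bas g) (bas h)) z
      + scl (ksign (par g) (par h)) (lie (bas h) (lie (bas g) z))" for g h :: "'a gen"
  proof -
    have "keys z \<subseteq> UNIV" by simp
    then show ?thesis
    proof (induction rule: supported_induct)
      case (step c k z)
      then show ?case
        by (simp add: lie_linear lie_bas jacobi_bas[of g h k] vec.scale_right_distrib mult.commute add_ac)
    qed simp
  qed
  have 2: "lie (bas g) (lie y z) = lie (lie (bas g) y) z
      + scl (ksign (par g) j) (lie y (lie (bas g) z))" for g
    using assms(2)
  proof (induction rule: supported_induct)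
    case (step c h y)
    then show ?case
      by (simp add: lie_linear 1[of g h] vec.scale_right_distrib mult.commute add_ac)
  qed simp
  show ?thesis
    using assms(1)
  proof (induction rule: supported_induct)
    case (step c g x)
    then show ?case
      by (simp add: lie_linear 2[of g] vec.scale_right_distrib mult.commute add_ac)
  qed simp
qed

section \<open>The diagonal actions of \<open>L 0\<close> and \<open>H 0\<close>\<close>

fun chg :: "'f::zero gen \<Rightarrow> 'g::{zero,one,uminus}" where
  "chg (L a) = 0" | "chg (H a) = 0" | "chg C = 0" | "chg (Gm a) = - 1" | "chg (Gp a) = 1"

text \<open>If one index is 0, the delta in the central term forces the other to be 0, where
  \<open>a^3 - a\<close> vanishes; so the action is diagonal. Both orders are recorded because
  \<open>ad y\<close> is tested with \<open>bas (L 0)\<close> on the right.\<close>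

lemma lookup_lie_L0:
  "lookup (lie (bas (L 0)) x) g = - deg g * lookup x g"
  "lookup (lie x (bas (L 0))) g = deg g * lookup x g"
proof -
  have 1: "lookup (brk (L 0) h) g = (if h = g then - deg g else 0)"
    "lookup (brk h (L 0)) g = (if h = g then deg g else 0)" for h
    by (cases h; auto simp: brk_central lookup_bas lookup_add lookup_minus delta_def)+
  have "keys x \<subseteq> UNIV" by simp
  then show "lookup (lie (bas (L 0)) x) g = - deg g * lookup x g"
    "lookup (lie x (bas (L 0))) g = deg g * lookup x g"
    by (induction rule: supported_induct)
       (simp_all add: lie_linear lookup_add lie_bas 1 lookup_bas algebra_simps)
qed

lemma lookup_lie_H0:
  "lookup (lie (bas (H 0)) x) g = chg g * lookup x g"
  "lookup (lie x (bas (H 0))) g = - chg g * lookup x g"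
proof -
  have 1: "lookup (brk (H 0) h) g = (if h = g then chg g else 0)"
    "lookup (brk h (H 0)) g = (if h = g then - chg g else 0)" for h
    by (cases h; auto simp: brk_central lookup_bas lookup_add lookup_minus delta_def)+
  have "keys x \<subseteq> UNIV" by simp
  then show "lookup (lie (bas (H 0)) x) g = chg g * lookup x g"
    "lookup (lie x (bas (H 0))) g = - chg g * lookup x g"
    by (induction rule: supported_induct)
       (simp_all add: lie_linear lookup_add lie_bas 1 lookup_bas algebra_simps)
qed

lemma mscl_apply: "mscl k D x = scl k (D x)"
  by (simp add: mscl_def)

section \<open>The algebra of a subgroup and its homogeneous components\<close>

locale ramond =
  fixes \<Gamma> :: "'f::field_char_0 set"
  assumes sub: "additive_subgroup \<Gamma>"
begin

lemma zero_in: "0 \<in> \<Gamma>" and add_in: "a \<in> \<Gamma> \<Longrightarrow> b \<in> \<Gamma> \<Longrightarrow> a + b \<in> \<Gamma>"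
  and minus_in: "a \<in> \<Gamma> \<Longrightarrow> - a \<in> \<Gamma>"
  using sub by (auto simp: additive_subgroup_def)

lemma gens_iff: "g \<in> gens \<Gamma> i \<longleftrightarrow> deg g \<in> \<Gamma> \<and> par g = i"
  using zero_in by (cases i; cases g) auto

lemma alg_iff: "x \<in> alg \<Gamma> \<longleftrightarrow> (\<forall>g\<in>keys x. deg g \<in> \<Gamma>)"
proof -
  have "g \<in> gens \<Gamma> 0 \<union> gens \<Gamma> 1 \<longleftrightarrow> deg g \<in> \<Gamma>" for g
    unfolding Un_iff gens_iff by (cases "par g") auto
  then show ?thesis unfolding alg_def span_bas by blast
qed

lemma alg_par_iff: "x \<in> alg_par \<Gamma> i \<longleftrightarrow> (\<forall>g\<in>keys x. deg g \<in> \<Gamma> \<and> par g = i)"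
  by (auto simp: alg_par_def span_bas gens_iff)

text \<open>Coefficientwise, the eigenvalue equation forces \<open>deg g = a\<close> wherever the
  coefficient is nonzero. For \<open>a\<close> outside \<Gamma> only the zero vector is
  left.\<close>

lemma alg_deg_iff: "x \<in> alg_deg \<Gamma> a \<longleftrightarrow> (\<forall>g\<in>keys x. deg g \<in> \<Gamma> \<and> deg g = a)"
proof -
  have "lie (bas (L 0)) x = scl (- a) x \<longleftrightarrow> (\<forall>g\<in>keys x. deg g = a)"
    by (auto simp: poly_mapping_eq_iff fun_eq_iff lookup_lie_L0 in_keys_iff)
  then show ?thesis by (auto simp: alg_deg_def alg_iff)
qed

lemma bas_alg [simp]: "bas g \<in> alg \<Gamma> \<longleftrightarrow> deg g \<in> \<Gamma>"
  by (simp add: alg_iff)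

lemma bas_alg_par: "deg g \<in> \<Gamma> \<Longrightarrow> bas g \<in> alg_par \<Gamma> (par g)"
  by (simp add: alg_par_iff)

lemma bas_alg_deg: "deg g \<in> \<Gamma> \<Longrightarrow> bas g \<in> alg_deg \<Gamma> (deg g)"
  by (simp add: alg_deg_iff)

lemma alg_closed [intro]:
  "0 \<in> alg \<Gamma>" "x \<in> alg \<Gamma> \<Longrightarrow> y \<in> alg \<Gamma> \<Longrightarrow> x + y \<in> alg \<Gamma>"
  "x \<in> alg \<Gamma> \<Longrightarrow> scl k x \<in> alg \<Gamma>"
  by (auto simp: alg_def intro: vec.span_zero vec.span_add vec.span_scale)

lemma alg_par_closed:
  "0 \<in> alg_par \<Gamma> i" "x \<in> alg_par \<Gamma> i \<Longrightarrow> y \<in> alg_par \<Gamma> i \<Longrightarrow> x + y \<in> alg_par \<Gamma> i"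
  "x \<in> alg_par \<Gamma> i \<Longrightarrow> scl k x \<in> alg_par \<Gamma> i"
  by (auto simp: alg_par_def intro: vec.span_zero vec.span_add vec.span_scale)

lemma alg_deg_closed:
  "0 \<in> alg_deg \<Gamma> a" "x \<in> alg_deg \<Gamma> a \<Longrightarrow> y \<in> alg_deg \<Gamma> a \<Longrightarrow> x + y \<in> alg_deg \<Gamma> a"
  "x \<in> alg_deg \<Gamma> a \<Longrightarrow> scl k x \<in> alg_deg \<Gamma> a"
  by (auto simp: alg_deg_def lie_linear vec.scale_right_distrib mult.commute)

lemma alg_par_alg: "x \<in> alg_par \<Gamma> i \<Longrightarrow> x \<in> alg \<Gamma>"
  by (auto simp: alg_iff alg_par_iff)

lemma alg_deg_alg: "x \<in> alg_deg \<Gamma> a \<Longrightarrow> x \<in> alg \<Gamma>"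
  by (auto simp: alg_deg_def)

lemma lie_alg:
  assumes "x \<in> alg \<Gamma>" "y \<in> alg \<Gamma>"
  shows "lie x y \<in> alg \<Gamma>"
  unfolding alg_iff
proof
  fix k assume "k \<in> keys (lie x y)"
  then show "deg k \<in> \<Gamma>" by (rule keys_lie) (use assms in \<open>simp add: alg_iff add_in\<close>)
qed

lemma lie_alg_par:
  assumes "x \<in> alg_par \<Gamma> i" "y \<in> alg_par \<Gamma> j"
  shows "lie x y \<in> alg_par \<Gamma> (i + j)"
  unfolding alg_par_iff
proof
  fix k assume "k \<in> keys (lie x y)"
  then show "deg k \<in> \<Gamma> \<and> par k = i + j"
    by (rule keys_lie) (use assms in \<open>simp add: alg_par_iff add_in\<close>)
qed

lemma lie_alg_deg:
  assumes "x \<in> alg_deg \<Gamma> a" "y \<in> alg_deg \<Gamma> b"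
  shows "lie x y \<in> alg_deg \<Gamma> (a + b)"
  unfolding alg_deg_iff
proof
  fix k assume "k \<in> keys (lie x y)"
  then show "deg k \<in> \<Gamma> \<and> deg k = a + b"
    by (rule keys_lie) (metis assms add_in alg_deg_iff)
qed

section \<open>Endomorphisms, derivations and inner derivations\<close>

lemma lin_endD:
  assumes "D \<in> lin_end \<Gamma>"
  shows "x \<in> alg \<Gamma> \<Longrightarrow> D x \<in> alg \<Gamma>" "x \<in> alg \<Gamma> \<Longrightarrow> y \<in> alg \<Gamma> \<Longrightarrow> D (x + y) = D x + D y"
    "x \<in> alg \<Gamma> \<Longrightarrow> D (scl k x) = scl k (D x)" "x \<notin> alg \<Gamma> \<Longrightarrow> D x = 0" "D 0 = 0"
  using assms alg_closed(1) vec.scale_zero_left[of 0] by (auto simp: lin_end_def) (metis vec.scale_zero_left)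

text \<open>Values on symbols determine the map on the algebra by linearity, and both maps vanish
  outside it, so they agree on the whole ambient space.\<close>

lemma lin_end_eqI:
  assumes "D \<in> lin_end \<Gamma>" "E \<in> lin_end \<Gamma>" "\<And>g. deg g \<in> \<Gamma> \<Longrightarrow> D (bas g) = E (bas g)"
  shows "D = E"
proof
  fix x
  show "D x = E x"
  proof (cases "x \<in> alg \<Gamma>")
    case True
    then have "keys x \<subseteq> {g. deg g \<in> \<Gamma>}" by (auto simp: alg_iff)
    then show ?thesis
    proof (induction rule: supported_induct)
      case zero
      show ?case using assms lin_endD(5) by metis
    next
      case (step c g y)
      then have "y \<in> alg \<Gamma>" "bas g \<in> alg \<Gamma>" by (auto simp: alg_iff)
      then show ?case using step assms by (simp add: lin_endD alg_closed)
    qed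
  next
    case False
    then show ?thesis using assms lin_endD(4) by metis
  qed
qed

lemma lin_end_subspace: "maps.subspace (lin_end \<Gamma>)"
  unfolding maps.subspace_def lin_end_def
  by (auto simp: mscl_apply alg_closed vec.scale_right_distrib mult.commute add_ac)

lemma Der_parD:
  assumes "D \<in> Der_par \<Gamma> j"
  shows "D \<in> lin_end \<Gamma>" "x \<in> alg_par \<Gamma> i \<Longrightarrow> D x \<in> alg_par \<Gamma> (i + j)"
    "x \<in> alg_par \<Gamma> i \<Longrightarrow> y \<in> alg \<Gamma> \<Longrightarrow>
      D (lie x y) = lie (D x) y + scl (ksign j i) (lie x (D y))"
  using assms by (auto simp: Der_par_def)

lemma Der_par_subspace: "maps.subspace (Der_par \<Gamma> j)"
  using lin_end_subspace unfolding maps.subspace_def Der_par_def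
  by (auto simp: mscl_apply alg_par_closed lie_linear vec.scale_right_distrib mult.commute add_ac)

text \<open>Both conditions extend from symbols by linearity. For the Leibniz rule this is done
  first in the second argument, then in a homogeneous first argument, whose fixed parity keeps the
  sign constant.\<close>

lemma Der_parI:
  assumes D: "D \<in> lin_end \<Gamma>"
    and par: "\<And>g. deg g \<in> \<Gamma> \<Longrightarrow> D (bas g) \<in> alg_par \<Gamma> (par g + j)"
    and der: "\<And>g h. deg g \<in> \<Gamma> \<Longrightarrow> deg h \<in> \<Gamma> \<Longrightarrow>
      D (brk g h) = lie (D (bas g)) (bas h) + scl (ksign j (par g)) (lie (bas g) (D (bas h)))"
  shows "D \<in> Der_par \<Gamma> j"
proof -
  note lin = lin_endD[OF D]
  have P: "D x \<in> alg_par \<Gamma> (i + j)" if "x \<in> alg_par \<Gamma> i" for x i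
  proof -
    have "keys x \<subseteq> {g. deg g \<in> \<Gamma> \<and> par g = i}" using that by (auto simp: alg_par_iff)
    then show ?thesis
    proof (induction rule: supported_induct)
      case (step c g y)
      then have "y \<in> alg \<Gamma>" "bas g \<in> alg \<Gamma>" by (auto simp: alg_iff)
      then show ?case using step par[of g] by (auto simp: lin alg_closed alg_par_closed)
    qed (simp add: lin alg_par_closed)
  qed
  have 1: "D (lie (bas g) y) = lie (D (bas g)) y + scl (ksign j (par g)) (lie (bas g) (D y))"
    if g: "deg g \<in> \<Gamma>" and "y \<in> alg \<Gamma>" for g y
  proof -
    have "keys y \<subseteq> {g. deg g \<in> \<Gamma>}" using that by (auto simp: alg_iff)
    then show ?thesis
    proof (induction rule: supported_induct)
      case (step c h y)
      then have y: "y \<in> alg \<Gamma>" "bas h \<in> alg \<Gamma>" by (auto simp: alg_iff)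
      moreover have "lie (bas g) y \<in> alg \<Gamma>" "lie (bas g) (bas h) \<in> alg \<Gamma>"
        using y g by (auto intro!: lie_alg)
      ultimately show ?case using step g
        by (simp add: lin alg_closed lie_linear lie_bas der vec.scale_right_distrib mult.commute)
    qed (simp add: lin)
  qed
  have "D (lie x y) = lie (D x) y + scl (ksign j i) (lie x (D y))"
    if "x \<in> alg_par \<Gamma> i" and y: "y \<in> alg \<Gamma>" for x i y
  proof -
    have "keys x \<subseteq> {g. deg g \<in> \<Gamma> \<and> par g = i}" using that by (auto simp: alg_par_iff)
    then show ?thesis
    proof (induction rule: supported_induct)
      case (step c g x)
      then have x: "x \<in> alg \<Gamma>" "bas g \<in> alg \<Gamma>" by (auto simp: alg_iff)
      moreover have "lie x y \<in> alg \<Gamma>" "lie (bas g) y \<in> alg \<Gamma>"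
        using x y by (auto intro!: lie_alg)
      ultimately show ?case using step y
        by (auto simp add: lin alg_closed lie_linear 1 vec.scale_right_distrib mult.commute)
    qed (simp add: lin)
  qed
  with D P show ?thesis by (simp add: Der_par_def)
qed

lemma ad_apply [simp]: "y \<in> alg \<Gamma> \<Longrightarrow> ad \<Gamma> x y = lie x y"
  by (simp add: ad_def)

lemma ad_linear: "ad \<Gamma> (x + y) = ad \<Gamma> x + ad \<Gamma> y" "ad \<Gamma> (scl k x) = mscl k (ad \<Gamma> x)"
  "ad \<Gamma> 0 = 0"
  by (auto simp: ad_def fun_eq_iff lie_linear mscl_apply)

text \<open>The Leibniz rule for \<open>ad\<close> is the super Jacobi identity.\<close>

lemma ad_Der_par:
  assumes x: "x \<in> alg_par \<Gamma> i"
  shows "ad \<Gamma> x \<in> Der_par \<Gamma> i"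
proof -
  have "x \<in> alg \<Gamma>" using x by (rule alg_par_alg)
  then have "ad \<Gamma> x \<in> lin_end \<Gamma>"
    by (auto simp: lin_end_def ad_def lie_linear lie_alg alg_closed)
  moreover have "ad \<Gamma> x y \<in> alg_par \<Gamma> (j + i)" if "y \<in> alg_par \<Gamma> j" for y j
    using lie_alg_par[OF x that] alg_par_alg[OF that] by (metis ad_apply add.commute)
  moreover have "ad \<Gamma> x (lie y z) = lie (ad \<Gamma> x y) z + scl (ksign i j) (lie y (ad \<Gamma> x z))"
    if "y \<in> alg_par \<Gamma> j" "z \<in> alg \<Gamma>" for j y z
    using that jacobi[of x i y j z] x alg_par_alg[OF that(1)]
    by (auto simp: lie_alg alg_par_iff)
  ultimately show ?thesis by (simp add: Der_par_def)
qed

lemma Der_par_diff: "D \<in> Der_par \<Gamma> j \<Longrightarrow> E \<in> Der_par \<Gamma> j \<Longrightarrow> D - E \<in> Der_par \<Gamma> j"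
  using maps.subspace_diff[OF Der_par_subspace] .

section \<open>Odd derivations are inner\<close>

lemma Der_par_odd_inner:
  assumes D: "D \<in> Der_par \<Gamma> 1"
  obtains y where "y \<in> alg_par \<Gamma> 1" "D = ad \<Gamma> y"
proof -
  have H0: "bas (H 0) \<in> alg_par \<Gamma> 0" and H0a: "bas (H 0) \<in> alg \<Gamma>"
    using zero_in by (auto simp: alg_par_iff alg_iff)
  define w where "w = D (bas (H 0))"
  have w: "w \<in> alg_par \<Gamma> 1"
    using Der_parD(2)[OF D H0] by (simp add: w_def)
  \<comment> \<open>Bracketing with \<open>bas (H 0)\<close> on the right multiplies coordinates by
    \<open>- chg g\<close>. On odd symbols this is 1 or -1, hence its own inverse, so the same
    factor solves for \<open>y\<close>.\<close>
  obtain y where y: "\<And>g. lookup y g = - chg g * lookup w g"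
    using ex_rescaled[of "\<lambda>g. - chg g" w] by blast
  have y1: "y \<in> alg_par \<Gamma> 1"
    using w by (auto simp: alg_par_iff in_keys_iff y)
  define E where "E = D - ad \<Gamma> y"
  have E: "E \<in> Der_par \<Gamma> 1"
    unfolding E_def by (intro Der_par_diff D ad_Der_par y1)
  have "lie y (bas (H 0)) = w"
  proof (rule poly_mapping_eqI)
    fix g
    have "lookup w g = 0 \<or> par g = 1" using w by (auto simp: alg_par_iff in_keys_iff)
    then show "lookup (lie y (bas (H 0))) g = lookup w g"
      by (cases g) (auto simp: lookup_lie_H0 y)
  qed
  then have EH0: "E (bas (H 0)) = 0"
    using H0a by (simp add: E_def w_def ad_apply)
  have "E (bas g) = 0" if g: "deg g \<in> \<Gamma>" for g
  proof (rule poly_mapping_eqI)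
    fix h
    have ga: "bas g \<in> alg \<Gamma>" using g by (simp add: bas_alg)
    have "lie (bas (H 0)) (bas g) = scl (chg g) (bas g)"
      by (rule poly_mapping_eqI) (simp add: lookup_lie_H0 lookup_bas)
    \<comment> \<open>Since \<open>E\<close> annihilates \<open>bas (H 0)\<close>, the Leibniz rule
      shows that \<open>E\<close> preserves the charge.\<close>
    then have "scl (chg g) (E (bas g)) = lie (bas (H 0)) (E (bas g))"
      using Der_parD(3)[OF E H0 ga] lin_endD(3)[OF Der_parD(1)[OF E] ga]
      by (simp add: EH0 ksign_def)
    then have "chg g * lookup (E (bas g)) h = chg h * lookup (E (bas g)) h"
      by (metis lookup_lie_H0(1) lookup_scl)
    \<comment> \<open>Even symbols have charge 0 and odd ones charge 1 or -1, so a change of parity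
      always changes the charge and every coefficient must vanish.\<close>
    moreover have "lookup (E (bas g)) h = 0 \<or> par h = par g + 1"
      using Der_parD(2)[OF E bas_alg_par[OF g]] unfolding alg_par_iff by (metis in_keys_iff)
    ultimately show "lookup (E (bas g)) h = lookup 0 h"
      by (cases g; cases h) auto
  qed
  then have "E = 0"
    using lin_end_eqI[OF Der_parD(1)[OF E], of 0] lin_end_subspace
    by (simp add: maps.subspace_def)
  then show ?thesis using that y1 by (simp add: E_def)
qed

section \<open>Even derivations modulo inner ones\<close>

text \<open>The clause about an arbitrary degree \<open>a\<close> serves derivations that are
  already homogeneous: the subtracted element then has the same degree.\<close>

lemma Der_par_even_mod_inner:
  assumes D: "D \<in> Der_par \<Gamma> 0"
  obtains y where "y \<in> alg_par \<Gamma> 0"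
    "\<And>a. D (bas (L 0)) \<in> alg_deg \<Gamma> a \<Longrightarrow> y \<in> alg_deg \<Gamma> a"
    "D - ad \<Gamma> y \<in> Der_par \<Gamma> 0"
    "\<And>g. deg g \<in> \<Gamma> \<Longrightarrow> (D - ad \<Gamma> y) (bas g) \<in> alg_deg \<Gamma> (deg g)"
proof -
  have L0: "bas (L 0) \<in> alg_par \<Gamma> 0" and L0a: "bas (L 0) \<in> alg \<Gamma>"
    using zero_in by (auto simp: alg_par_iff alg_iff)
  define w where "w = D (bas (L 0))"
  have w: "w \<in> alg_par \<Gamma> 0"
    using Der_parD(2)[OF D L0] by (simp add: w_def)
  \<comment> \<open>In nonzero degree the factor inverts the eigenvalue \<open>deg g\<close> of
    bracketing with \<open>bas (L 0)\<close> on the right. Since \<open>inverse 0 = 0\<close>,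
    \<open>y\<close> has no part of degree 0 and that part of \<open>w\<close> stays.\<close>
  obtain y where y: "\<And>g. lookup y g = inverse (deg g) * lookup w g"
    using ex_rescaled[of "\<lambda>g. inverse (deg g)" w] by blast
  have y0: "y \<in> alg_par \<Gamma> 0"
    using w by (auto simp: alg_par_iff in_keys_iff y)
  have yd: "y \<in> alg_deg \<Gamma> a" if "w \<in> alg_deg \<Gamma> a" for a
    using that by (auto simp: alg_deg_iff in_keys_iff y)
  define E where "E = D - ad \<Gamma> y"
  have E: "E \<in> Der_par \<Gamma> 0"
    unfolding E_def by (intro Der_par_diff D ad_Der_par y0)
  have EL0: "E (bas (L 0)) \<in> alg_deg \<Gamma> 0"
  proof -
    have *: "E (bas (L 0)) \<in> alg \<Gamma>"
      using lin_endD(1)[OF Der_parD(1)[OF E] L0a] .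
    have "lookup (E (bas (L 0))) g = 0" if "deg g \<noteq> 0" for g
      using L0a that by (simp add: E_def w_def[symmetric] ad_apply lookup_minus lookup_lie_L0 y)
    with * show ?thesis by (auto simp: alg_deg_iff alg_iff in_keys_iff)
  qed
  have "E (bas g) \<in> alg_deg \<Gamma> (deg g)" if g: "deg g \<in> \<Gamma>" for g
  proof -
    have ga: "bas g \<in> alg \<Gamma>" using g by (simp add: bas_alg)
    have *: "E (bas g) \<in> alg \<Gamma>"
      using lin_endD(1)[OF Der_parD(1)[OF E] ga] .
    have "lie (bas (L 0)) (bas g) = scl (- deg g) (bas g)"
      by (rule poly_mapping_eqI) (simp add: lookup_lie_L0 lookup_bas)
    \<comment> \<open>The first summand has degree \<open>deg g\<close>, because
      \<open>E (bas (L 0))\<close> has degree 0. In any other degree the equation says that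
      \<open>E (bas g)\<close> has the eigenvalue of degree \<open>deg g\<close>, so its coefficient
      there is 0.\<close>
    then have eq: "scl (- deg g) (E (bas g)) = lie (E (bas (L 0))) (bas g) + lie (bas (L 0)) (E (bas g))"
      using Der_parD(3)[OF E L0 ga] lin_endD(3)[OF Der_parD(1)[OF E] ga, of "- deg g"]
      by (simp add: ksign_def)
    have d: "lie (E (bas (L 0))) (bas g) \<in> alg_deg \<Gamma> (deg g)"
      using lie_alg_deg[OF EL0 bas_alg_deg[OF g]] by simp
    have "lookup (E (bas g)) h = 0" if "deg h \<noteq> deg g" for h
    proof -
      have "lookup (lie (E (bas (L 0))) (bas g)) h = 0"
        using d that by (auto simp: alg_deg_iff in_keys_iff)
      then have "- deg g * lookup (E (bas g)) h = - deg h * lookup (E (bas g)) h"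
        using arg_cong[OF eq, of "\<lambda>x. lookup x h"] by (simp add: lookup_add lookup_lie_L0)
      with that show ?thesis by simp
    qed
    with * show ?thesis by (auto simp: alg_deg_iff alg_iff in_keys_iff)
  qed
  then show ?thesis using that[of y] y0 yd E unfolding E_def w_def by blast
qed

section \<open>Even derivations of degree zero\<close>

text \<open>Degree and parity leave the image of each symbol at most three coordinates, which the
  brackets with odd symbols determine. The nonzero \<open>\<gamma>\<close> supplies the index at
  which the equations for the degree 0 symbols become conclusive. The witnesses are \<open>q\<close>
  for \<open>\<phi>\<close> and \<open>r 0\<close> for \<open>l\<close>.\<close>

lemma Der_par_even_degree_zero:
  assumes D: "D \<in> Der_par \<Gamma> 0" and \<gamma>: "\<gamma> \<in> \<Gamma>" "\<gamma> \<noteq> 0"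
    and deg0: "\<And>g. deg g \<in> \<Gamma> \<Longrightarrow> D (bas g) \<in> alg_deg \<Gamma> (deg g)"
  obtains \<phi> l where "\<phi> \<in> add_homs \<Gamma>"
    "\<And>g. deg g \<in> \<Gamma> \<Longrightarrow> D (bas g) = scl (\<phi> (deg g) + l * chg g) (bas g)"
proof -
  note lin = lin_endD[OF Der_parD(1)[OF D]]
  have der: "D (brk g h) = lie (D (bas g)) (bas h) + lie (bas g) (D (bas h))"
    if "deg g \<in> \<Gamma>" "deg h \<in> \<Gamma>" for g h
    using Der_parD(3)[OF D bas_alg_par[OF that(1)], of "bas h"] that
    by (simp add: ksign_def lie_bas)
  have supp: "lookup (D (bas g)) h = 0"
    if "deg g \<in> \<Gamma>" "deg h \<noteq> deg g \<or> par h \<noteq> par g" for g h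
    using that deg0[OF that(1)] Der_parD(2)[OF D bas_alg_par[OF that(1)]]
    unfolding alg_deg_iff alg_par_iff by (metis add_0_right in_keys_iff)
  \<comment> \<open>By \<open>supp\<close>, no other coordinates can be nonzero. The aim is that
    only the diagonal ones \<open>a\<close>, \<open>q\<close>, \<open>r\<close>, \<open>r'\<close>
    survive, with \<open>a = q\<close> and with \<open>r\<close>, \<open>r'\<close> differing from
    \<open>q\<close> by opposite constants.\<close>
  define a where "a \<alpha> = lookup (D (bas (L \<alpha>))) (L \<alpha>)" for \<alpha>
  define b where "b \<alpha> = lookup (D (bas (L \<alpha>))) (H \<alpha>)" for \<alpha>
  define e where "e \<alpha> = lookup (D (bas (L \<alpha>))) C" for \<alpha>
  define p where "p \<alpha> = lookup (D (bas (H \<alpha>))) (L \<alpha>)" for \<alpha>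
  define q where "q \<alpha> = lookup (D (bas (H \<alpha>))) (H \<alpha>)" for \<alpha>
  define f where "f \<alpha> = lookup (D (bas (H \<alpha>))) C" for \<alpha>
  define r where "r \<alpha> = lookup (D (bas (Gp \<alpha>))) (Gp \<alpha>)" for \<alpha>
  define s where "s \<alpha> = lookup (D (bas (Gp \<alpha>))) (Gm \<alpha>)" for \<alpha>
  define r' where "r' \<alpha> = lookup (D (bas (Gm \<alpha>))) (Gm \<alpha>)" for \<alpha>
  define s' where "s' \<alpha> = lookup (D (bas (Gm \<alpha>))) (Gp \<alpha>)" for \<alpha>
  define u where "u = lookup (D (bas C)) (L 0)"
  define v where "v = lookup (D (bas C)) (H 0)"
  define t where "t = lookup (D (bas C)) C"
  have DL: "D (bas (L \<alpha>)) = scl (a \<alpha>) (bas (L \<alpha>)) + scl (b \<alpha>) (bas (H \<alpha>)) + scl (e \<alpha>) (bas C)"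
    if "\<alpha> \<in> \<Gamma>" for \<alpha>
  proof (rule poly_mapping_eqI)
    fix k show "lookup (D (bas (L \<alpha>))) k =
        lookup (scl (a \<alpha>) (bas (L \<alpha>)) + scl (b \<alpha>) (bas (H \<alpha>)) + scl (e \<alpha>) (bas C)) k"
      using supp[of "L \<alpha>" k] that
      by (cases k) (auto simp: lookup_add lookup_bas a_def b_def e_def)
  qed
  have e0: "e \<alpha> = 0" if "\<alpha> \<in> \<Gamma>" "\<alpha> \<noteq> 0" for \<alpha>
    using supp[of "L \<alpha>" C] that by (simp add: e_def)
  have DH: "D (bas (H \<alpha>)) = scl (p \<alpha>) (bas (L \<alpha>)) + scl (q \<alpha>) (bas (H \<alpha>)) + scl (f \<alpha>) (bas C)"
    if "\<alpha> \<in> \<Gamma>" for \<alpha>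
  proof (rule poly_mapping_eqI)
    fix k show "lookup (D (bas (H \<alpha>))) k =
        lookup (scl (p \<alpha>) (bas (L \<alpha>)) + scl (q \<alpha>) (bas (H \<alpha>)) + scl (f \<alpha>) (bas C)) k"
      using supp[of "H \<alpha>" k] that
      by (cases k) (auto simp: lookup_add lookup_bas p_def q_def f_def)
  qed
  have f0: "f \<alpha> = 0" if "\<alpha> \<in> \<Gamma>" "\<alpha> \<noteq> 0" for \<alpha>
    using supp[of "H \<alpha>" C] that by (simp add: f_def)
  have DGp: "D (bas (Gp \<alpha>)) = scl (r \<alpha>) (bas (Gp \<alpha>)) + scl (s \<alpha>) (bas (Gm \<alpha>))"
    if "\<alpha> \<in> \<Gamma>" for \<alpha>
  proof (rule poly_mapping_eqI)
    fix k show "lookup (D (bas (Gp \<alpha>))) k =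
        lookup (scl (r \<alpha>) (bas (Gp \<alpha>)) + scl (s \<alpha>) (bas (Gm \<alpha>))) k"
      using supp[of "Gp \<alpha>" k] that
      by (cases k) (auto simp: lookup_add lookup_bas r_def s_def)
  qed
  have DGm: "D (bas (Gm \<alpha>)) = scl (r' \<alpha>) (bas (Gm \<alpha>)) + scl (s' \<alpha>) (bas (Gp \<alpha>))"
    if "\<alpha> \<in> \<Gamma>" for \<alpha>
  proof (rule poly_mapping_eqI)
    fix k show "lookup (D (bas (Gm \<alpha>))) k =
        lookup (scl (r' \<alpha>) (bas (Gm \<alpha>)) + scl (s' \<alpha>) (bas (Gp \<alpha>))) k"
      using supp[of "Gm \<alpha>" k] that
      by (cases k) (auto simp: lookup_add lookup_bas r'_def s'_def)
  qed
  have DC: "D (bas C) = scl u (bas (L 0)) + scl v (bas (H 0)) + scl t (bas C)"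
  proof (rule poly_mapping_eqI)
    fix k show "lookup (D (bas C)) k =
        lookup (scl u (bas (L 0)) + scl v (bas (H 0)) + scl t (bas C)) k"
      using supp[of C k] zero_in
      by (cases k) (auto simp: lookup_add lookup_bas u_def v_def t_def)
  qed

  have HGp: "r (\<alpha> + \<beta>) = p \<alpha> * (\<alpha> / 2 - \<beta>) + q \<alpha> + r \<beta>" "s (\<alpha> + \<beta>) = - s \<beta>"
    if "\<alpha> \<in> \<Gamma>" "\<beta> \<in> \<Gamma>" for \<alpha> \<beta>
  proof -
    have eq: "D (bas (Gp (\<alpha> + \<beta>))) = lie (D (bas (H \<alpha>))) (bas (Gp \<beta>)) + lie (bas (H \<alpha>)) (D (bas (Gp \<beta>)))"
      using der[of "H \<alpha>" "Gp \<beta>"] that by simp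
    show "r (\<alpha> + \<beta>) = p \<alpha> * (\<alpha> / 2 - \<beta>) + q \<alpha> + r \<beta>"
      using arg_cong[OF eq, of "\<lambda>x. lookup x (Gp (\<alpha> + \<beta>))"] that
      by (simp add: DH DGp add_in lie_linear lie_bas lookup_add lookup_minus lookup_bas)
    show "s (\<alpha> + \<beta>) = - s \<beta>"
      using arg_cong[OF eq, of "\<lambda>x. lookup x (Gm (\<alpha> + \<beta>))"] that
      by (simp add: DH DGp add_in lie_linear lie_bas lookup_add lookup_minus lookup_bas)
  qed
  have HGm: "r' (\<alpha> + \<beta>) = - p \<alpha> * (\<alpha> / 2 - \<beta>) + q \<alpha> + r' \<beta>" "s' (\<alpha> + \<beta>) = - s' \<beta>"
    if "\<alpha> \<in> \<Gamma>" "\<beta> \<in> \<Gamma>" for \<alpha> \<beta>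
  proof -
    have "D (- bas (Gm (\<alpha> + \<beta>))) = - D (bas (Gm (\<alpha> + \<beta>)))"
      using lin(3)[of "bas (Gm (\<alpha> + \<beta>))" "- 1"] that by (simp add: add_in)
    then have eq: "- D (bas (Gm (\<alpha> + \<beta>))) = lie (D (bas (H \<alpha>))) (bas (Gm \<beta>)) + lie (bas (H \<alpha>)) (D (bas (Gm \<beta>)))"
      using der[of "H \<alpha>" "Gm \<beta>"] that by simp
    show "r' (\<alpha> + \<beta>) = - p \<alpha> * (\<alpha> / 2 - \<beta>) + q \<alpha> + r' \<beta>"
      using arg_cong[OF eq, of "\<lambda>x. lookup x (Gm (\<alpha> + \<beta>))"] that
      by (simp add: DH DGm add_in lie_linear lie_bas lookup_add lookup_minus lookup_bas field_simps)
    show "s' (\<alpha> + \<beta>) = - s' \<beta>"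
      using arg_cong[OF eq, of "\<lambda>x. lookup x (Gp (\<alpha> + \<beta>))"] that
      by (simp add: DH DGm add_in lie_linear lie_bas lookup_add lookup_minus lookup_bas) (simp add: minus_equation_iff)
  qed
  have LGp: "(\<alpha> / 2 - \<beta>) * r (\<alpha> + \<beta>) = a \<alpha> * (\<alpha> / 2 - \<beta>) + b \<alpha> + (\<alpha> / 2 - \<beta>) * r \<beta>"
    if "\<alpha> \<in> \<Gamma>" "\<beta> \<in> \<Gamma>" for \<alpha> \<beta>
  proof -
    have eq: "scl (\<alpha> / 2 - \<beta>) (D (bas (Gp (\<alpha> + \<beta>)))) = lie (D (bas (L \<alpha>))) (bas (Gp \<beta>)) + lie (bas (L \<alpha>)) (D (bas (Gp \<beta>)))"
      using der[of "L \<alpha>" "Gp \<beta>"] lin(3)[of "bas (Gp (\<alpha> + \<beta>))"] that by (simp add: add_in)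
    show ?thesis
      using arg_cong[OF eq, of "\<lambda>x. lookup x (Gp (\<alpha> + \<beta>))"] that
      by (simp add: DL DGp add_in lie_linear lie_bas lookup_add lookup_minus lookup_bas mult.commute)
  qed

  \<comment> \<open>Taking \<alpha> = 0 makes each value its own negative; the sign stems from the
    opposite charges of \<open>Gp\<close> and \<open>Gm\<close>.\<close>
  have s: "s \<beta> = 0" "s' \<beta> = 0" if "\<beta> \<in> \<Gamma>" for \<beta>
    using HGp(2)[OF zero_in that] HGm(2)[OF zero_in that] by simp_all
  \<comment> \<open>Inserting \<open>HGp\<close> into \<open>LGp\<close> cancels
    \<open>r \<beta>\<close> and leaves a polynomial relation in \<open>X\<close> whose coefficients
    depend on \<alpha> alone.\<close>
  have quad: "p \<alpha> * X\<^sup>2 + (q \<alpha> - a \<alpha>) * X = b \<alpha>"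
    if "\<alpha> \<in> \<Gamma>" "\<beta> \<in> \<Gamma>" "X = \<alpha> / 2 - \<beta>" for \<alpha> \<beta> X
    using LGp[OF that(1,2)] unfolding HGp(1)[OF that(1,2)] that(3)[symmetric]
    by (simp add: algebra_simps power2_eq_square)
  have pqb: "p \<alpha> = 0 \<and> q \<alpha> = a \<alpha> \<and> b \<alpha> = 0" if \<alpha>: "\<alpha> \<in> \<Gamma>" for \<alpha>
  proof (cases "\<alpha> = 0")
    case False
    \<comment> \<open>The choices \<beta> = 0, \<alpha>, -\<alpha> give \<open>X\<close> the values
      \<alpha>/2, -\<alpha>/2 and 3\<alpha>/2. The first two differ in sign and isolate the linear
      term; the third separates \<open>p\<close> from \<open>b\<close>.\<close>
    have 1: "p \<alpha> * (\<alpha> / 2)\<^sup>2 + (q \<alpha> - a \<alpha>) * (\<alpha> / 2) = b \<alpha>"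
      using quad[OF \<alpha> zero_in, of "\<alpha> / 2"] by simp
    have 2: "p \<alpha> * (- (\<alpha> / 2))\<^sup>2 + (q \<alpha> - a \<alpha>) * (- (\<alpha> / 2)) = b \<alpha>"
      using quad[OF \<alpha> \<alpha>, of "- (\<alpha> / 2)"] by simp
    have 3: "p \<alpha> * (3 * \<alpha> / 2)\<^sup>2 + (q \<alpha> - a \<alpha>) * (3 * \<alpha> / 2) = b \<alpha>"
      by (rule quad[OF \<alpha> minus_in[OF \<alpha>]]) simp
    have "(q \<alpha> - a \<alpha>) * (\<alpha> / 2) = (q \<alpha> - a \<alpha>) * (- (\<alpha> / 2))"
      using 1 2 by (metis power2_minus add_left_cancel)
    then have qa: "q \<alpha> = a \<alpha>" using False by simp
    have "p \<alpha> * \<alpha>\<^sup>2 = 4 * b \<alpha>" using 1 qa by (simp add: field_simps power2_eq_square)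
    moreover have "9 * (p \<alpha> * \<alpha>\<^sup>2) = 4 * b \<alpha>" using 3 qa by (simp add: field_simps power2_eq_square)
    ultimately have "8 * (p \<alpha> * \<alpha>\<^sup>2) = 0" by algebra
    then have "p \<alpha> = 0" using False by simp
    with qa 1 show ?thesis by simp
  next
    case True
    \<comment> \<open>For \<alpha> = 0 the three values of \<open>X\<close> coincide, so the index
      \<open>\<gamma>\<close> takes over.\<close>
    have q0: "q 0 = 0" using HGp(1)[OF zero_in zero_in] by simp
    then have p0: "p 0 = 0" using HGp(1)[OF zero_in \<gamma>(1)] \<gamma>(2) by simp
    have b0: "b 0 = 0" using quad[OF zero_in zero_in, of 0] by simp
    then have "a 0 = 0" using quad[OF zero_in \<gamma>(1), of "- \<gamma>"] \<gamma>(2) q0 p0 by simp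
    with True q0 p0 b0 show ?thesis by simp
  qed
  have r: "r \<alpha> = q \<alpha> + r 0" if "\<alpha> \<in> \<Gamma>" for \<alpha>
    using HGp(1)[OF that zero_in] pqb[OF that] by simp
  have r': "r' \<alpha> = q \<alpha> + r' 0" if "\<alpha> \<in> \<Gamma>" for \<alpha>
    using HGm(1)[OF that zero_in] pqb[OF that] by simp
  have qadd: "q (\<alpha> + \<beta>) = q \<alpha> + q \<beta>" if "\<alpha> \<in> \<Gamma>" "\<beta> \<in> \<Gamma>" for \<alpha> \<beta>
    using HGp(1)[OF that] pqb[OF that(1)] r that by (simp add: add_in)
  then have q: "q \<in> add_homs \<Gamma>" by (simp add: add_homs_def)
  have q0: "q 0 = 0" using qadd[OF zero_in zero_in] by simp
  have qm: "q (- \<alpha>) = - q \<alpha>" if "\<alpha> \<in> \<Gamma>" for \<alpha>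
    using qadd[OF that minus_in[OF that]] q0 by (simp add: eq_neg_iff_add_eq_0 add.commute)

  \<comment> \<open>As \<open>C\<close> is central, \<open>D (bas C)\<close> must commute with
    \<open>Gp \<gamma>\<close> and \<open>Gm \<gamma>\<close>. Their opposite charges give
    \<open>v - u * \<gamma> = 0\<close> and \<open>- v - u * \<gamma> = 0\<close>.\<close>
  have uv: "u = 0" "v = 0"
  proof -
    have p: "lie (D (bas C)) (bas (Gp \<gamma>)) = 0" and m: "lie (D (bas C)) (bas (Gm \<gamma>)) = 0"
      using der[of C "Gp \<gamma>"] der[of C "Gm \<gamma>"] zero_in \<gamma>(1) lin(5) by (simp_all add: lie_bas_C)
    have "v - u * \<gamma> = 0"
      using arg_cong[OF p, of "\<lambda>x. lookup x (Gp \<gamma>)"]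
      by (simp add: DC lie_linear lie_bas lookup_add lookup_minus lookup_bas)
    moreover have "- v - u * \<gamma> = 0"
      using arg_cong[OF m, of "\<lambda>x. lookup x (Gm \<gamma>)"]
      by (simp add: DC lie_linear lie_bas lookup_add lookup_minus lookup_bas) auto
    ultimately have "2 * v = 0" "2 * (u * \<gamma>) = 0" by algebra+
    then show "u = 0" "v = 0" using \<gamma>(2) by simp_all
  qed

  \<comment> \<open>Opposite indices are chosen so that the bracket has degree 0 and its central
    term appears; the index difference is then 2\<alpha>.\<close>
  have GG: "scl (r' \<alpha> + r (- \<alpha>)) (brk (Gm \<alpha>) (Gp (- \<alpha>))) =
      scl 2 (D (bas (L 0))) - scl (2 * \<alpha>) (D (bas (H 0))) + scl ((\<alpha>\<^sup>2 - 1/4) / 3) (D (bas C))"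
    if \<alpha>: "\<alpha> \<in> \<Gamma>" for \<alpha>
  proof -
    have in_alg: "bas (L 0) \<in> alg \<Gamma>" "bas (H 0) \<in> alg \<Gamma>" "bas C \<in> alg \<Gamma>"
      using zero_in by simp_all
    have brk: "brk (Gm \<alpha>) (Gp (- \<alpha>)) =
        scl 2 (bas (L 0)) + (scl (- (2 * \<alpha>)) (bas (H 0)) + scl ((\<alpha>\<^sup>2 - 1/4) / 3) (bas C))"
      by (simp add: brk_central)
    have "scl (r' \<alpha> + r (- \<alpha>)) (brk (Gm \<alpha>) (Gp (- \<alpha>))) = D (brk (Gm \<alpha>) (Gp (- \<alpha>)))"
      using der[of "Gm \<alpha>" "Gp (- \<alpha>)"] \<alpha> minus_in[OF \<alpha>]
      by (simp add: DGm DGp s lie_linear lie_bas vec.scale_left_distrib del: brk.simps)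
    also have "\<dots> = scl 2 (D (bas (L 0))) + (scl (- (2 * \<alpha>)) (D (bas (H 0))) + scl ((\<alpha>\<^sup>2 - 1/4) / 3) (D (bas C)))"
      unfolding brk using in_alg by (simp only: lin(2,3) alg_closed)
    finally show ?thesis by simp
  qed
  \<comment> \<open>The \<open>L 0\<close> coefficient of \<open>GG\<close> at \<alpha> = 0, where
    \<open>a 0 = q 0 = 0\<close>. Thus \<open>Gp\<close> and \<open>Gm\<close> get opposite
    constants, as under a multiple of \<open>ad\<close> of \<open>bas (H 0)\<close>.\<close>
  have rr: "r' 0 = - r 0"
  proof -
    have "(r' 0 + r 0) * 2 = 0"
      using arg_cong[OF GG[OF zero_in], of "\<lambda>x. lookup x (L 0)"] pqb[OF zero_in] zero_in q0
      by (simp add: brk_central DL DH DC uv lookup_add lookup_minus lookup_bas algebra_simps)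
    then have "r' 0 + r 0 = 0" by (metis mult_eq_0_iff zero_neq_numeral)
    then show ?thesis by (simp add: eq_neg_iff_add_eq_0)
  qed
  \<comment> \<open>The scalar on the left of \<open>GG\<close> is now zero, so the \<open>C\<close>
    coefficient is a polynomial in \<alpha> vanishing on \<Gamma>. Comparing \<open>\<gamma>\<close>
    with its negative gives \<open>f 0 = 0\<close>, comparing it with 0 gives \<open>t = 0\<close>,
    and evaluating at 0 gives \<open>e 0 = 0\<close>.\<close>
  have central: "0 = 2 * e 0 - 2 * \<alpha> * f 0 + (\<alpha>\<^sup>2 - 1/4) / 3 * t" if "\<alpha> \<in> \<Gamma>" for \<alpha>
  proof -
    have "r' \<alpha> + r (- \<alpha>) = 0"
      using r[OF minus_in[OF that]] r'[OF that] rr qm[OF that] by simp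
    then show ?thesis
      using arg_cong[OF GG[OF that], of "\<lambda>x. lookup x C"] zero_in
      by (simp add: DL DH DC lookup_add lookup_minus lookup_bas del: brk.simps)
  qed
  have "4 * (\<gamma> * f 0) = (2 * e 0 - 2 * (- \<gamma>) * f 0 + ((- \<gamma>)\<^sup>2 - 1/4) / 3 * t)
      - (2 * e 0 - 2 * \<gamma> * f 0 + (\<gamma>\<^sup>2 - 1/4) / 3 * t)"
    by (simp add: algebra_simps)
  also have "\<dots> = 0"
    by (simp only: central[OF \<gamma>(1), symmetric] central[OF minus_in[OF \<gamma>(1)], symmetric] diff_self)
  finally have f00: "f 0 = 0" using \<gamma>(2) by simp
  have "\<gamma>\<^sup>2 * t = 3 * ((2 * e 0 - 2 * \<gamma> * f 0 + (\<gamma>\<^sup>2 - 1/4) / 3 * t)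
      - (2 * e 0 - 2 * 0 * f 0 + (0\<^sup>2 - 1/4) / 3 * t))"
    using f00 by (simp add: field_simps)
  also have "\<dots> = 0"
    by (simp only: central[OF \<gamma>(1), symmetric] central[OF zero_in, symmetric] diff_self) simp
  finally have "\<gamma>\<^sup>2 * t = 0" .
  then have t0: "t = 0" using \<gamma>(2) by simp
  have e00: "e 0 = 0" using central[OF zero_in] t0 by simp
  have ef: "e \<alpha> = 0" "f \<alpha> = 0" if "\<alpha> \<in> \<Gamma>" for \<alpha>
    using e0[OF that] f0[OF that] e00 f00 by metis+
  have "D (bas g) = scl (q (deg g) + r 0 * chg g) (bas g)" if "deg g \<in> \<Gamma>" for g
  proof (cases g)
    case (L \<alpha>)
    with that show ?thesis using pqb[of \<alpha>] by (simp add: DL ef)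
  next
    case (H \<alpha>)
    with that show ?thesis using pqb[of \<alpha>] by (simp add: DH ef)
  next
    case C
    then show ?thesis by (simp add: DC uv t0 q0)
  next
    case (Gm \<alpha>)
    with that show ?thesis using r'[of \<alpha>] rr by (simp add: DGm s)
  next
    case (Gp \<alpha>)
    with that show ?thesis using r[of \<alpha>] by (simp add: DGp s)
  qed
  then show ?thesis using that q by blast
qed

section \<open>The space of derivations and the two kinds of generators\<close>

lemma Der_parI_Der: "D \<in> Der_par \<Gamma> j \<Longrightarrow> D \<in> Der \<Gamma>"
proof (cases j)
  have 0: "0 \<in> Der_par \<Gamma> i" for i
    using Der_par_subspace by (simp add: maps.subspace_def)
  assume D: "D \<in> Der_par \<Gamma> j"
  show "D \<in> Der \<Gamma>" if "j = 0"
    unfolding Der_def using D that 0[of 1] by (intro CollectI exI[of _ D] exI[of _ 0]) simp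
  show "D \<in> Der \<Gamma>" if "j = 1"
    unfolding Der_def using D that 0[of 0] by (intro CollectI exI[of _ 0] exI[of _ D]) simp
qed

lemma Der_subspace: "maps.subspace (Der \<Gamma>)"
proof -
  have "Der \<Gamma> = {D + E | D E. D \<in> Der_par \<Gamma> 0 \<and> E \<in> Der_par \<Gamma> 1}"
    by (simp add: Der_def)
  then show ?thesis
    using maps.subspace_sums[OF Der_par_subspace[of 0] Der_par_subspace[of 1]] by simp
qed

lemma Der_lin_end: "D \<in> Der \<Gamma> \<Longrightarrow> D \<in> lin_end \<Gamma>"
  using lin_end_subspace Der_parD(1) by (auto simp: Der_def intro: maps.subspace_add)

lemma Der_degD:
  assumes "D \<in> Der_deg \<Gamma> a"
  shows "D \<in> Der \<Gamma>" "b \<in> \<Gamma> \<Longrightarrow> x \<in> alg_deg \<Gamma> b \<Longrightarrow> D x \<in> alg_deg \<Gamma> (b + a)"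
  using assms by (auto simp: Der_deg_def)

lemma Der_deg_subspace: "maps.subspace (Der_deg \<Gamma> a)"
  using Der_subspace unfolding maps.subspace_def Der_deg_def
  by (auto simp: mscl_apply alg_deg_closed)

text \<open>A general \<open>x\<close> mixes parities, but it is a combination of symbols, which are
  homogeneous, and \<open>Der \<Gamma>\<close> is a subspace.\<close>

lemma ad_Der:
  assumes "x \<in> alg \<Gamma>"
  shows "ad \<Gamma> x \<in> Der \<Gamma>"
proof -
  have "keys x \<subseteq> {g. deg g \<in> \<Gamma>}" using assms by (auto simp: alg_iff)
  then show ?thesis
  proof (induction rule: supported_induct)
    case zero
    then show ?case by (simp only: ad_linear(3) maps.subspace_0[OF Der_subspace])
  next
    case (step c g y)
    then have "ad \<Gamma> (bas g) \<in> Der \<Gamma>"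
      by (auto intro: Der_parI_Der[OF ad_Der_par[OF bas_alg_par]])
    then show ?case
      unfolding ad_linear
      by (intro maps.subspace_add[OF Der_subspace] maps.subspace_scale[OF Der_subspace] step.IH)
  qed
qed

lemma ad_Der_deg:
  assumes "x \<in> alg_deg \<Gamma> a"
  shows "ad \<Gamma> x \<in> Der_deg \<Gamma> a"
  using ad_Der[OF alg_deg_alg[OF assms]] lie_alg_deg[OF assms]
  by (simp add: Der_deg_def alg_deg_alg add.commute)

lemma hom_ders_bas:
  assumes "E \<in> hom_ders \<Gamma>"
  obtains \<phi> where "\<phi> \<in> add_homs \<Gamma>" "\<And>a x. a \<in> \<Gamma> \<Longrightarrow> x \<in> alg_deg \<Gamma> a \<Longrightarrow> E x = scl (\<phi> a) x"
  using assms by (auto simp: hom_ders_def)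

text \<open>Since degrees add under the bracket, the Leibniz rule on symbols is the additivity of
  \<open>\<phi>\<close>.\<close>

lemma hom_ders_Der_par:
  assumes "E \<in> hom_ders \<Gamma>"
  shows "E \<in> Der_par \<Gamma> 0"
proof -
  obtain \<phi> where \<phi>: "\<phi> \<in> add_homs \<Gamma>"
    and E: "\<And>a x. a \<in> \<Gamma> \<Longrightarrow> x \<in> alg_deg \<Gamma> a \<Longrightarrow> E x = scl (\<phi> a) x"
    using hom_ders_bas[OF assms] by blast
  have Eb: "E (bas g) = scl (\<phi> (deg g)) (bas g)" if "deg g \<in> \<Gamma>" for g
    using E[OF that bas_alg_deg[OF that]] .
  show ?thesis
  proof (rule Der_parI)
    show "E \<in> lin_end \<Gamma>" using assms by (simp add: hom_ders_def)
    show "E (bas g) \<in> alg_par \<Gamma> (par g + 0)" if "deg g \<in> \<Gamma>" for g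
      using bas_alg_par[OF that] Eb[OF that] alg_par_closed(3) by (metis add_0_right)
    show "E (brk g h) = lie (E (bas g)) (bas h) + scl (ksign 0 (par g)) (lie (bas g) (E (bas h)))"
      if g: "deg g \<in> \<Gamma>" and h: "deg h \<in> \<Gamma>" for g h
    proof -
      have "brk g h \<in> alg_deg \<Gamma> (deg g + deg h)"
        using lie_alg_deg[OF bas_alg_deg[OF g] bas_alg_deg[OF h]] by (simp add: lie_bas)
      then have "E (brk g h) = scl (\<phi> (deg g) + \<phi> (deg h)) (brk g h)"
        using E[OF add_in[OF g h]] \<phi> g h by (simp add: add_homs_def)
      then show ?thesis
        using g h by (simp add: Eb lie_linear lie_bas ksign_def vec.scale_left_distrib)
    qed
  qed
qed

lemma hom_ders_Der_deg:
  assumes "E \<in> hom_ders \<Gamma>"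
  shows "E \<in> Der_deg \<Gamma> 0"
proof -
  obtain \<phi> where E: "\<And>a x. a \<in> \<Gamma> \<Longrightarrow> x \<in> alg_deg \<Gamma> a \<Longrightarrow> E x = scl (\<phi> a) x"
    using hom_ders_bas[OF assms] by blast
  show ?thesis
    using Der_parI_Der[OF hom_ders_Der_par[OF assms]]
    by (simp add: Der_deg_def E alg_deg_closed)
qed

text \<open>The charge term of the preceding normal form is \<open>ad\<close> of
  \<open>scl l (bas (H 0))\<close>. The remainder is scalar on symbols and is extended to
  homogeneous vectors, on which \<open>hom_ders\<close> is defined.\<close>

lemma Der_par_even_degree_zero_decomp:
  assumes D: "D \<in> Der_par \<Gamma> 0" and "\<gamma> \<in> \<Gamma>" "\<gamma> \<noteq> 0"
    and deg0: "\<And>g. deg g \<in> \<Gamma> \<Longrightarrow> D (bas g) \<in> alg_deg \<Gamma> (deg g)"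
  obtains l E where "E \<in> hom_ders \<Gamma>" "D = ad \<Gamma> (scl l (bas (H 0))) + E"
proof -
  obtain \<phi> l where \<phi>: "\<phi> \<in> add_homs \<Gamma>"
    and Db: "\<And>g. deg g \<in> \<Gamma> \<Longrightarrow> D (bas g) = scl (\<phi> (deg g) + l * chg g) (bas g)"
    using Der_par_even_degree_zero[OF assms] by blast
  define E where "E = D - ad \<Gamma> (scl l (bas (H 0)))"
  have "scl l (bas (H 0)) \<in> alg_par \<Gamma> 0"
    using bas_alg_par[of "H 0"] zero_in by (simp add: alg_par_closed)
  then have "E \<in> Der_par \<Gamma> 0"
    unfolding E_def by (intro Der_par_diff D ad_Der_par)
  then have E: "E \<in> lin_end \<Gamma>" by (rule Der_parD(1))
  have Eb: "E (bas g) = scl (\<phi> (deg g)) (bas g)" if "deg g \<in> \<Gamma>" for g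
    using that
    by (intro poly_mapping_eqI)
       (auto simp: E_def Db lie_linear lookup_minus lookup_lie_H0 lookup_bas)
  have "E x = scl (\<phi> a) x" if "a \<in> \<Gamma>" "x \<in> alg_deg \<Gamma> a" for a x
  proof -
    have "keys x \<subseteq> {g. deg g \<in> \<Gamma> \<and> deg g = a}" using that by (auto simp: alg_deg_iff)
    then show ?thesis
    proof (induction rule: supported_induct)
      case zero
      then show ?case by (simp add: lin_endD(5)[OF E])
    next
      case (step c g y)
      then have "y \<in> alg \<Gamma>" "bas g \<in> alg \<Gamma>" by (auto simp: alg_iff)
      with step show ?case
        by (auto simp: lin_endD[OF E] alg_closed Eb vec.scale_right_distrib mult.commute)
    qed
  qed
  then have "E \<in> hom_ders \<Gamma>" using E \<phi> by (auto simp: hom_ders_def)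
  moreover have "D = ad \<Gamma> (scl l (bas (H 0))) + E" by (simp add: E_def)
  ultimately show ?thesis using that by blast
qed

section \<open>Generators of the derivation space and its direct sum decompositions\<close>

lemma Der_deg_bas: "D \<in> Der_deg \<Gamma> a \<Longrightarrow> deg g \<in> \<Gamma> \<Longrightarrow> D (bas g) \<in> alg_deg \<Gamma> (deg g + a)"
  using Der_degD(2) bas_alg_deg by blast

lemma Der_eq_span:
  assumes "\<gamma> \<in> \<Gamma>" "\<gamma> \<noteq> 0"
  shows "Der \<Gamma> = maps.span (ad \<Gamma> ` alg \<Gamma> \<union> hom_ders \<Gamma>)"
proof
  show "Der \<Gamma> \<subseteq> maps.span (ad \<Gamma> ` alg \<Gamma> \<union> hom_ders \<Gamma>)" (is "_ \<subseteq> ?S")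
  proof
    fix D assume "D \<in> Der \<Gamma>"
    then obtain D0 D1 where D: "D = D0 + D1" "D0 \<in> Der_par \<Gamma> 0" "D1 \<in> Der_par \<Gamma> 1"
      by (auto simp: Der_def)
    have ad: "ad \<Gamma> y \<in> ?S" if "y \<in> alg \<Gamma>" for y
      using that by (intro maps.span_base UnI1 imageI)
    obtain z where z: "z \<in> alg_par \<Gamma> 1" "D1 = ad \<Gamma> z"
      using Der_par_odd_inner[OF D(3)] by blast
    obtain y where y: "y \<in> alg_par \<Gamma> 0" "D0 - ad \<Gamma> y \<in> Der_par \<Gamma> 0"
      "\<And>g. deg g \<in> \<Gamma> \<Longrightarrow> (D0 - ad \<Gamma> y) (bas g) \<in> alg_deg \<Gamma> (deg g)"
      by (rule Der_par_even_mod_inner[OF D(2)]) (rule that, assumption+)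
    obtain l E where E: "E \<in> hom_ders \<Gamma>" "D0 - ad \<Gamma> y = ad \<Gamma> (scl l (bas (H 0))) + E"
      by (rule Der_par_even_degree_zero_decomp[OF y(2) assms y(3)])
    have "scl l (bas (H 0)) \<in> alg \<Gamma>" using zero_in by (simp add: alg_closed)
    moreover have "E \<in> ?S" using E(1) by (intro maps.span_base UnI2)
    ultimately have "(ad \<Gamma> y + (ad \<Gamma> (scl l (bas (H 0))) + E)) + ad \<Gamma> z \<in> ?S"
      using z(1) y(1) by (intro maps.span_add ad) (auto intro: alg_par_alg)
    also have "ad \<Gamma> y + (ad \<Gamma> (scl l (bas (H 0))) + E) = D0"
      by (simp only: E(2)[symmetric] add.commute[of "ad \<Gamma> y"] diff_add_cancel)
    finally show "D \<in> ?S" by (simp only: D(1) z(2))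
  qed
  show "?S \<subseteq> Der \<Gamma>"
  proof (rule maps.span_minimal[OF _ Der_subspace])
    show "ad \<Gamma> ` alg \<Gamma> \<union> hom_ders \<Gamma> \<subseteq> Der \<Gamma>"
      using ad_Der Der_parI_Der[OF hom_ders_Der_par] by blast
  qed
qed

text \<open>A common grading argument for the \<open>\<Gamma>\<close>-grading (\<open>d = deg\<close>) and the parity grading (\<open>d = par\<close>).\<close>
lemma graded_endomorphisms_independent:
  fixes d :: "'f gen \<Rightarrow> 'i::cancel_semigroup_add"
  assumes "finite J" and f: "\<And>i. i \<in> J \<Longrightarrow> f i \<in> lin_end \<Gamma>" and sum0: "(\<Sum>i\<in>J. f i) = 0"
    and d: "\<And>i g h. i \<in> J \<Longrightarrow> deg g \<in> \<Gamma> \<Longrightarrow> lookup (f i (bas g)) h \<noteq> 0 \<Longrightarrow> d h = d g + i"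
    and "j \<in> J"
  shows "f j = 0"
proof (rule lin_end_eqI)
  show "f j \<in> lin_end \<Gamma>" "0 \<in> lin_end \<Gamma>"
    using f \<open>j \<in> J\<close> lin_end_subspace by (auto simp: maps.subspace_def)
  fix g assume g: "deg g \<in> \<Gamma>"
  show "f j (bas g) = 0 (bas g)"
  proof (rule poly_mapping_eqI)
    fix h
    show "lookup (f j (bas g)) h = lookup (0 (bas g)) h"
    proof (cases "d h = d g + j")
      case True
      \<comment> \<open>By left cancellation, \<open>d g + i\<close> and \<open>d g + j\<close>
        differ for distinct \<open>i\<close> and \<open>j\<close>, so only \<open>f j\<close>
        contributes to the coefficient at \<open>h\<close>.\<close>
      have "lookup (f i (bas g)) h = 0" if "i \<in> J" "i \<noteq> j" for i
        using d[OF that(1) g, of h] True that(2) by auto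
      then have "lookup (f j (bas g)) h = (\<Sum>i\<in>J. lookup (f i (bas g)) h)"
        using assms(1) \<open>j \<in> J\<close> by (simp add: sum.remove)
      also have "\<dots> = lookup ((\<Sum>i\<in>J. f i) (bas g)) h"
        by (simp add: sum_fun_apply lookup_sum)
      finally show ?thesis by (simp add: sum0)
    next
      case False
      then show ?thesis using d[OF \<open>j \<in> J\<close> g] by auto
    qed
  qed
qed

text \<open>Spanning follows from \<open>Der_eq_span\<close>: \<open>ad x\<close> is a finite
  combination of homogeneous \<open>ad (bas g)\<close>, and \<open>hom_ders\<close> lies in degree
  0. Hence each derivation has finitely many components, even for infinite \<Gamma>.\<close>

lemma Der_degree_sum:
  assumes "\<gamma> \<in> \<Gamma>" "\<gamma> \<noteq> 0"
  shows "internal_direct_sum (Der \<Gamma>) \<Gamma> (Der_deg \<Gamma>)"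
  unfolding internal_direct_sum_def
proof (intro conjI ballI allI impI)
  let ?S = "maps.span (\<Union>i\<in>\<Gamma>. Der_deg \<Gamma> i)"
  show "maps.subspace (Der_deg \<Gamma> i)" for i by (rule Der_deg_subspace)
  have base: "D \<in> ?S" if "D \<in> Der_deg \<Gamma> a" "a \<in> \<Gamma>" for D a
    using that by (intro maps.span_base UN_I)
  have "ad \<Gamma> x \<in> ?S" if "x \<in> alg \<Gamma>" for x
  proof -
    have "keys x \<subseteq> {g. deg g \<in> \<Gamma>}" using that by (auto simp: alg_iff)
    then show ?thesis
    proof (induction rule: supported_induct)
      case zero
      then show ?case by (simp only: ad_linear(3) maps.span_zero)
    next
      case (step c g y)
      then have "ad \<Gamma> (bas g) \<in> ?S"
        by (intro base[OF ad_Der_deg[OF bas_alg_deg]]) auto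
      then show ?case
        unfolding ad_linear by (intro maps.span_add maps.span_scale step.IH)
    qed
  qed
  moreover have "E \<in> ?S" if "E \<in> hom_ders \<Gamma>" for E
    using base[OF hom_ders_Der_deg[OF that] zero_in] .
  ultimately have "Der \<Gamma> \<subseteq> ?S"
    unfolding Der_eq_span[OF assms] by (intro maps.span_minimal maps.subspace_span Un_least image_subsetI subsetI)
  moreover have "?S \<subseteq> Der \<Gamma>"
    using Der_degD(1) by (intro maps.span_minimal[OF _ Der_subspace] UN_least subsetI)
  ultimately show "Der \<Gamma> = ?S" by blast
next
  fix J f j
  assume *: "finite J \<and> J \<subseteq> \<Gamma> \<and> (\<forall>i\<in>J. f i \<in> Der_deg \<Gamma> i) \<and> (\<Sum>i\<in>J. f i) = 0" and "j \<in> J"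
  show "f j = 0"
  proof (rule graded_endomorphisms_independent[where d = deg])
    show "f i \<in> lin_end \<Gamma>" if "i \<in> J" for i
      using * that Der_lin_end[OF Der_degD(1)] by blast
    show "deg h = deg g + i" if "i \<in> J" "deg g \<in> \<Gamma>" "lookup (f i (bas g)) h \<noteq> 0" for i g h
      using * that Der_deg_bas[of "f i" i g] by (metis alg_deg_iff in_keys_iff)
  qed (use * \<open>j \<in> J\<close> in auto)
qed

lemma Der_parity_sum: "internal_direct_sum (Der \<Gamma>) UNIV (Der_par \<Gamma>)"
  unfolding internal_direct_sum_def
proof (intro conjI ballI allI impI)
  let ?S = "maps.span (\<Union>i. Der_par \<Gamma> i)"
  show "maps.subspace (Der_par \<Gamma> i)" for i by (rule Der_par_subspace)
  have "Der \<Gamma> \<subseteq> ?S"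
    unfolding Der_def by (blast intro: maps.span_add maps.span_base)
  moreover have "?S \<subseteq> Der \<Gamma>"
    using Der_parI_Der by (intro maps.span_minimal[OF _ Der_subspace] UN_least subsetI)
  ultimately show "Der \<Gamma> = ?S" by blast
next
  fix J f j
  assume *: "finite J \<and> J \<subseteq> UNIV \<and> (\<forall>i\<in>J. f i \<in> Der_par \<Gamma> i) \<and> (\<Sum>i\<in>J. f i) = 0" and "j \<in> J"
  show "f j = 0"
  proof (rule graded_endomorphisms_independent[where d = par])
    show "f i \<in> lin_end \<Gamma>" if "i \<in> J" for i
      using * that Der_parD(1) by blast
    show "par h = par g + i" if "i \<in> J" "deg g \<in> \<Gamma>" "lookup (f i (bas g)) h \<noteq> 0" for i g h
      using * that Der_parD(2)[of "f i" i, OF _ bas_alg_par[of g]] by (metis alg_par_iff in_keys_iff)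
  qed (use * \<open>j \<in> J\<close> in auto)
qed

section \<open>Even derivations of a fixed degree\<close>

text \<open>Subtracting the inner derivation, itself of degree \<open>a\<close>, leaves a map that
  is both of degree \<open>a\<close> and degree-preserving. For nonzero \<open>a\<close> it must be
  0.\<close>

lemma Der_par_even_Der_deg:
  assumes "a \<noteq> 0"
  shows "Der_par \<Gamma> 0 \<inter> Der_deg \<Gamma> a = ad \<Gamma> ` (alg_par \<Gamma> 0 \<inter> alg_deg \<Gamma> a)"
proof
  show "ad \<Gamma> ` (alg_par \<Gamma> 0 \<inter> alg_deg \<Gamma> a) \<subseteq> Der_par \<Gamma> 0 \<inter> Der_deg \<Gamma> a"
    using ad_Der_par ad_Der_deg by auto
  show "Der_par \<Gamma> 0 \<inter> Der_deg \<Gamma> a \<subseteq> ad \<Gamma> ` (alg_par \<Gamma> 0 \<inter> alg_deg \<Gamma> a)"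
  proof
    fix D assume "D \<in> Der_par \<Gamma> 0 \<inter> Der_deg \<Gamma> a"
    then have D: "D \<in> Der_par \<Gamma> 0" and Da: "D \<in> Der_deg \<Gamma> a" by auto
    obtain y where y: "y \<in> alg_par \<Gamma> 0"
      "D (bas (L 0)) \<in> alg_deg \<Gamma> a \<Longrightarrow> y \<in> alg_deg \<Gamma> a"
      "D - ad \<Gamma> y \<in> Der_par \<Gamma> 0"
      "\<And>g. deg g \<in> \<Gamma> \<Longrightarrow> (D - ad \<Gamma> y) (bas g) \<in> alg_deg \<Gamma> (deg g)"
      by (rule Der_par_even_mod_inner[OF D]) (rule that, assumption+)
    have ya: "y \<in> alg_deg \<Gamma> a"
      using y(2) Der_deg_bas[OF Da, of "L 0"] zero_in by simp
    have Ea: "D - ad \<Gamma> y \<in> Der_deg \<Gamma> a"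
      by (rule maps.subspace_diff[OF Der_deg_subspace Da ad_Der_deg[OF ya]])
    have "(D - ad \<Gamma> y) (bas g) = 0" if "deg g \<in> \<Gamma>" for g
    proof -
      have "\<forall>h\<in>keys ((D - ad \<Gamma> y) (bas g)). deg h = deg g \<and> deg h = deg g + a"
        using y(4)[OF that] Der_deg_bas[OF Ea that] unfolding alg_deg_iff by blast
      with assms have "keys ((D - ad \<Gamma> y) (bas g)) = {}"
        by (metis add_0_right add_left_cancel all_not_in_conv)
      then show ?thesis by (simp only: keys_eq_empty)
    qed
    then have "D - ad \<Gamma> y = 0"
      by (intro lin_end_eqI[OF Der_parD(1)[OF y(3)] maps.subspace_0[OF lin_end_subspace]])
         (simp only: zero_fun_apply)
    then have "D = ad \<Gamma> y" by (simp only: right_minus_eq)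
    with y(1) ya show "D \<in> ad \<Gamma> ` (alg_par \<Gamma> 0 \<inter> alg_deg \<Gamma> a)" by blast
  qed
qed

lemma span_L0_H0:
  assumes "x \<in> vec.span {bas (L 0), bas (H 0)}"
  shows "x \<in> alg_par \<Gamma> 0" "x \<in> alg_deg \<Gamma> 0"
proof -
  have "keys x \<subseteq> {L 0, H 0}" using assms span_bas[of "{L 0, H 0} :: 'f gen set"] by simp
  then show "x \<in> alg_par \<Gamma> 0" "x \<in> alg_deg \<Gamma> 0"
    using zero_in by (auto simp: alg_par_iff alg_deg_iff)
qed

text \<open>The sum is not direct: \<open>ad\<close> of \<open>bas (L 0)\<close> acts on degree
  \<alpha> by -\<alpha> and so lies in both summands. The decomposition found here uses a multiple
  of \<open>bas (H 0)\<close>.\<close>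

lemma Der_par_even_Der_deg_zero:
  assumes "\<gamma> \<in> \<Gamma>" "\<gamma> \<noteq> 0"
  shows "Der_par \<Gamma> 0 \<inter> Der_deg \<Gamma> 0
    = {D + E | D E. D \<in> ad \<Gamma> ` vec.span {bas (L 0), bas (H 0)} \<and> E \<in> hom_ders \<Gamma>}" (is "_ = ?R")
proof
  show "Der_par \<Gamma> 0 \<inter> Der_deg \<Gamma> 0 \<subseteq> ?R"
  proof
    fix D assume "D \<in> Der_par \<Gamma> 0 \<inter> Der_deg \<Gamma> 0"
    then have D: "D \<in> Der_par \<Gamma> 0" and D0: "D \<in> Der_deg \<Gamma> 0" by auto
    have b: "D (bas g) \<in> alg_deg \<Gamma> (deg g)" if "deg g \<in> \<Gamma>" for g
      using Der_deg_bas[OF D0 that] by simp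
    obtain l E where "E \<in> hom_ders \<Gamma>" "D = ad \<Gamma> (scl l (bas (H 0))) + E"
      by (rule Der_par_even_degree_zero_decomp[OF D assms b])
    moreover have "scl l (bas (H 0)) \<in> vec.span {bas (L 0), bas (H 0)}"
      by (intro vec.span_scale vec.span_base) simp
    ultimately show "D \<in> ?R" by blast
  qed
  show "?R \<subseteq> Der_par \<Gamma> 0 \<inter> Der_deg \<Gamma> 0"
  proof
    fix F assume "F \<in> ?R"
    then obtain x E where F: "F = ad \<Gamma> x + E" and x: "x \<in> vec.span {bas (L 0), bas (H 0)}"
      and E: "E \<in> hom_ders \<Gamma>"
      by blast
    have "F \<in> Der_par \<Gamma> 0"
      unfolding F using ad_Der_par[OF span_L0_H0(1)[OF x]] hom_ders_Der_par[OF E]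
      by (rule maps.subspace_add[OF Der_par_subspace])
    moreover have "F \<in> Der_deg \<Gamma> 0"
      unfolding F using ad_Der_deg[OF span_L0_H0(2)[OF x]] hom_ders_Der_deg[OF E]
      by (rule maps.subspace_add[OF Der_deg_subspace])
    ultimately show "F \<in> Der_par \<Gamma> 0 \<inter> Der_deg \<Gamma> 0" by blast
  qed
qed

text \<open>An element of degree 0 involves only \<open>L 0\<close>, \<open>H 0\<close>,
  \<open>C\<close>, \<open>Gp 0\<close> and \<open>Gm 0\<close>. Testing an even \<open>ad x\<close>
  on \<open>bas (H 0)\<close> excludes the two odd symbols, since their charges are nonzero, and the
  \<open>C\<close> part acts as 0.\<close>

lemma Der_par_even_ad_alg_deg_zero:
  "Der_par \<Gamma> 0 \<inter> ad \<Gamma> ` alg_deg \<Gamma> 0 = {ad \<Gamma> (scl k (bas (L 0)) + scl l (bas (H 0))) | k l. True}"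
  (is "_ = ?R")
proof
  show "?R \<subseteq> Der_par \<Gamma> 0 \<inter> ad \<Gamma> ` alg_deg \<Gamma> 0"
  proof
    fix D assume "D \<in> ?R"
    then obtain k l where D: "D = ad \<Gamma> (scl k (bas (L 0)) + scl l (bas (H 0)))" by blast
    have "scl k (bas (L 0)) + scl l (bas (H 0)) \<in> vec.span {bas (L 0), bas (H 0)}"
      by (intro vec.span_add vec.span_scale vec.span_base) auto
    then show "D \<in> Der_par \<Gamma> 0 \<inter> ad \<Gamma> ` alg_deg \<Gamma> 0"
      using span_L0_H0 ad_Der_par D by blast
  qed
  show "Der_par \<Gamma> 0 \<inter> ad \<Gamma> ` alg_deg \<Gamma> 0 \<subseteq> ?R"
  proof
    fix D assume "D \<in> Der_par \<Gamma> 0 \<inter> ad \<Gamma> ` alg_deg \<Gamma> 0"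
    then obtain x where x: "x \<in> alg_deg \<Gamma> 0" and D: "D = ad \<Gamma> x" "ad \<Gamma> x \<in> Der_par \<Gamma> 0"
      by blast
    have "lie x (bas (H 0)) \<in> alg_par \<Gamma> 0"
      using Der_parD(2)[OF D(2) bas_alg_par[of "H 0"]] zero_in by simp
    then have "lookup (lie x (bas (H 0))) g = 0" if "par g \<noteq> 0" for g
      using that unfolding alg_par_iff by (metis in_keys_iff)
    from this[of "Gp 0"] this[of "Gm 0"] have odd: "lookup x (Gp 0) = 0" "lookup x (Gm 0) = 0"
      by (simp_all add: lookup_lie_H0)
    have supp: "lookup x g = 0" if "deg g \<noteq> 0" for g
      using x that unfolding alg_deg_iff by (metis in_keys_iff)
    have "x = scl (lookup x (L 0)) (bas (L 0)) + scl (lookup x (H 0)) (bas (H 0))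
        + scl (lookup x C) (bas C)" (is "x = ?y")
    proof (rule poly_mapping_eqI)
      fix g show "lookup x g = lookup ?y g"
        using supp[of g] odd by (cases g) (auto simp: lookup_add lookup_bas)
    qed
    then have "ad \<Gamma> x = ad \<Gamma> ?y" by (rule arg_cong)
    also have "\<dots> = ad \<Gamma> (scl (lookup x (L 0)) (bas (L 0)) + scl (lookup x (H 0)) (bas (H 0)))"
      by (simp add: ad_def lie_linear lie_bas_C fun_eq_iff)
    finally show "D \<in> ?R" using D(1) by blast
  qed
qed

end

theorem theorem2p3:
  fixes \<Gamma> :: "'f::field_char_0 set"
  assumes "additive_subgroup \<Gamma>" and "\<Gamma> \<noteq> {0}"
  shows "Der \<Gamma> = maps.span (ad \<Gamma> ` alg \<Gamma> \<union> hom_ders \<Gamma>)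
    \<and> internal_direct_sum (Der \<Gamma>) \<Gamma> (Der_deg \<Gamma>)
    \<and> internal_direct_sum (Der \<Gamma>) UNIV (Der_par \<Gamma>)
    \<and> Der_par \<Gamma> 1 = ad \<Gamma> ` alg_par \<Gamma> 1
    \<and> (\<forall>\<alpha>\<in>\<Gamma>. \<alpha> \<noteq> 0 \<longrightarrow>
         Der_par \<Gamma> 0 \<inter> Der_deg \<Gamma> \<alpha> = ad \<Gamma> ` (alg_par \<Gamma> 0 \<inter> alg_deg \<Gamma> \<alpha>))
    \<and> Der_par \<Gamma> 0 \<inter> Der_deg \<Gamma> 0
        = {D + E | D E. D \<in> ad \<Gamma> ` vec.span {bas (L 0), bas (H 0)} \<and> E \<in> hom_ders \<Gamma>}
    \<and> Der_par \<Gamma> 0 \<inter> ad \<Gamma> ` alg_deg \<Gamma> 0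
        = {ad \<Gamma> (scl k (bas (L 0)) + scl l (bas (H 0))) | k l. True}"
proof -
  interpret ramond \<Gamma> by standard fact
  obtain \<gamma> where \<gamma>: "\<gamma> \<in> \<Gamma>" "\<gamma> \<noteq> 0" using assms(2) zero_in by blast
  have "Der_par \<Gamma> 1 = ad \<Gamma> ` alg_par \<Gamma> 1"
    using ad_Der_par Der_par_odd_inner by blast
  then show ?thesis
    by (intro conjI ballI impI Der_eq_span[OF \<gamma>] Der_degree_sum[OF \<gamma>] Der_parity_sum
        Der_par_even_Der_deg Der_par_even_Der_deg_zero[OF \<gamma>] Der_par_even_ad_alg_deg_zero)
qed

end
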